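(* Let $\mathscr{C}=(S,V_1,V_2,\Pi_1,\Pi_2,\langle\ ,\ \rangle)$ be a Coxeter datum, and let $\alpha\in\Phi_1(\mathscr{C})$ and $t\in S$ be arbitrary. Then $$\mathrm{coeff}_t(\alpha)>0\ \text{ if and only if }\ \mathrm{coeff}_t(\phi(\alpha))>0,$$ and in this case $\mathrm{coeff}_t(\alpha)\,\mathrm{coeff}_t(\phi(\alpha))\ge1$. In particular, $\phi(\mathrm{supp}(\alpha))=\mathrm{supp}(\phi(\alpha))$. Furthermore, suppose that $1\le\mathrm{coeff}_t(\alpha)\,\mathrm{coeff}_t(\phi(\alpha))<4$. Then either $\mathrm{coeff}_t(\alpha)\,\mathrm{coeff}_t(\phi(\alpha))=1$, or else $\mathrm{coeff}_t(\alpha)\,\mathrm{coeff}_t(\phi(\alpha))=4\cos^2(\pi/m)$, where $m=m_{r_1r_2}$ for some $r_1,r_2\in S$ with $4\le m<\infty$. In particular, if $\alpha\in\Phi_1^+(\mathscr{C})$ then $\mathrm{coeff}_t(\alpha)\,\mathrm{coeff}_t(\phi(\alpha))=1$ if and only if $\mathrm{coeff}_t(\phi_1(\alpha))=1$.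
   Context: **Coxeter datum.** Let $S$ be an arbitrary set in which each unordered pair $\{s,t\}$ of elements is assigned an $m_{st}\in\mathbb{Z}\cup\{\infty\}$ with $m_{ss}=1$ for all $s\in S$ and $m_{st}\ge 2$ for all distinct $s,t\in S$. For a subset $A$ of a real vector space, $\mathrm{PLC}(A)=\{\sum_{a\in A}\lambda_a a\mid \lambda_a\ge 0 \text{ for all } a\in A, \text{ and } \lambda_{a'}>0\text{ for some }a'\in A\}$ (finite sums). A Coxeter datum with Coxeter parameters $m_{st}$ is a tuple $\mathscr{C}=(S,V_1,V_2,\Pi_1,\Pi_2,\langle\ ,\ \rangle)$ where $V_1,V_2$ are real vector spaces, $\langle\ ,\ \rangle\colon V_1\times V_2\to\mathbb{R}$ is bilinear, $\Pi_1=\{\alpha_s\mid s\in S\}\subseteq V_1$ and $\Pi_2=\{\beta_s\mid s\in S\}\subseteq V_2$, such that: (C1) $\langle\alpha_s,\beta_s\rangle=1$ for all $s\in S$; (C2) $\langle\alpha_s,\beta_t\rangle\le 0$ for all distinct $s,t\in S$; (C3) for all $s,t\in S$, $\langle\alpha_s,\beta_t\rangle\langle\alpha_t,\beta_s\rangle=\cos^2(\pi/m_{st})$ if $m_{st}\ne\infty$, and equals $\gamma^2$ for some $\gamma\ge1$ (depending on $s,t$) if $m_{st}=\infty$; (C4) $\langle\alpha_s,\beta_t\rangle=0$ if and only if $\langle\alpha_t,\beta_s\rangle=0$, for all $s,t\in S$; (C5) $0\notin\mathrm{PLC}(\Pi_1)$ and $0\notin\mathrm{PLC}(\Pi_2)$,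 in the sense that $\sum_{s\in S}\lambda_s\alpha_s=0$ with all $\lambda_s\ge0$ implies all $\lambda_s=0$, and likewise for the $\beta_s$. Linear independence of $\Pi_1,\Pi_2$ is not assumed. **Action and roots.** $(W,R)$, $R=\{r_s\mid s\in S\}$, is the abstract Coxeter system with parameters $m_{st}$ (relations $r_s^2=1$, $(r_sr_t)^{m_{st}}=1$ for $m_{st}\neq\infty$). $W$ acts on $V_1,V_2$ by $r_sx=x-2\langle x,\beta_s\rangle\alpha_s$ and $r_sy=y-2\langle\alpha_s,y\rangle\beta_s$. Put $\Phi_i(\mathscr{C})=W\Pi_i$ and $\Phi_i^+(\mathscr{C})=\Phi_i(\mathscr{C})\cap\mathrm{PLC}(\Pi_i)$ for $i=1,2$. The map $\phi\colon\Phi_1(\mathscr{C})\to\Phi_2(\mathscr{C})$ is the (unique, well-defined) $W$-equivariant bijection with $\phi(\alpha_s)=\beta_s$ for all $s\in S$. **Canonical coefficients and support.** Let $V_1',V_2'$ be real vector spaces with bases $\{\alpha_s'\}_{s\in S}$, $\{\beta_s'\}_{s\in S}$ and bilinear map $\langle\alpha_s',\beta_t'\rangle'=\langle\alpha_s,\beta_t\rangle$; this is a Coxeter datum $\mathscr{C}'$ with the same parameters, so $W$ acts on $V_1',V_2'$ by the same formulas, with root systems $\Phi_i(\mathscr{C}')$. The linear maps $\pi_1\colon\alpha_s'\mapsto\alpha_s$ and $\pi_2\colon\beta_s'\mapsto\beta_s$ restrict to $W$-equivariant bijections $\Phi_i(\mathscr{C}')\to\Phi_i(\mathscr{C})$.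 For $z\in\Phi_1(\mathscr{C})$ (resp. $z\in\Phi_2(\mathscr{C})$), $\mathrm{coeff}_s(z)$ is the coefficient of $\alpha_s'$ (resp. $\beta_s'$) in the basis expansion of the unique root $z'\in\Phi_i(\mathscr{C}')$ with $\pi_i(z')=z$. For $\alpha\in\Phi_1(\mathscr{C})$, $\mathrm{supp}(\alpha)=\{\alpha_s\mid\mathrm{coeff}_s(\alpha)\ne0\}$; for $\beta\in\Phi_2(\mathscr{C})$, $\mathrm{supp}(\beta)=\{\beta_s\mid\mathrm{coeff}_s(\beta)\ne0\}$. **Standard geometric realization.** Let $V$ be a real vector space with basis $\{\gamma_s\mid s\in S\}$ and symmetric bilinear form $(\,,\,)$ with $(\gamma_s,\gamma_s)=1$ for all $s$, $(\gamma_s,\gamma_t)\le0$ for all $s\ne t$, and $(\gamma_s,\gamma_t)^2=\langle\alpha_s,\beta_t\rangle\langle\alpha_t,\beta_s\rangle$ for all $s,t$. $W$ acts on $V$ by $r_sv=v-2(v,\gamma_s)\gamma_s$; $\Phi=\{w\gamma_s\mid w\in W,s\in S\}$. For $\gamma\in\Phi$, $\mathrm{coeff}_s(\gamma)$ is the coefficient of $\gamma_s$ in $\gamma$. The map $\phi_1\colon\Phi_1(\mathscr{C})\to\Phi$ is the (well-defined) $W$-equivariant map with $\phi_1(\alpha_s)=\gamma_s$ for all $s\in S$. *)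

theory Defs
  imports "HOL-Analysis.Analysis" "HOL-Algebra.Group" "HOL-Library.Extended_Nat"
begin

text \<open>The tuple $(S, V_1, V_2, \Pi_1, \Pi_2, \langle\,,\rangle)$ with its parameters $m_{st}$.
  The vector spaces are the types \<^typ>\<open>'a\<close> and \<^typ>\<open>'b\<close>; \<open>root1\<close> and \<open>root2\<close> are the families
  $s \mapsto \alpha_s$ and $s \mapsto \beta_s$, of which only the values on \<open>index\<close> matter.\<close>

record ('s, 'a, 'b) coxeter_tuple =
  index :: "'s set"
  param :: "'s \<Rightarrow> 's \<Rightarrow> enat"
  root1 :: "'s \<Rightarrow> 'a"
  root2 :: "'s \<Rightarrow> 'b"
  pairing :: "'a \<Rightarrow> 'b \<Rightarrow> real"

definition PLC :: "'a::real_vector set \<Rightarrow> 'a set" where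
  "PLC A = {(\<Sum>a\<in>F. l a *\<^sub>R a) | F l.
     finite F \<and> F \<subseteq> A \<and> (\<forall>a\<in>F. 0 \<le> l a) \<and> (\<exists>a\<in>F. 0 < l a)}"

text \<open>The last condition says that $\sum_s \lambda_s \alpha_s = 0$ with all $\lambda_s \ge 0$ forces all
  $\lambda_s = 0$, and likewise for $\beta$. Here the coefficients are attached to vectors rather
  than to elements of $S$; this makes no difference, since $\langle\alpha_s,\beta_s\rangle = 1$ and
  $\langle\alpha_s,\beta_t\rangle \le 0$ for $s \ne t$ make both families injective on $S$.\<close>

definition coxeter_datum :: "('s, 'a::real_vector, 'b::real_vector) coxeter_tuple \<Rightarrow> bool" where
  "coxeter_datum C \<longleftrightarrow>
     (\<forall>s\<in>index C. param C s s = 1) \<and>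
     (\<forall>s\<in>index C. \<forall>t\<in>index C. param C s t = param C t s) \<and>
     (\<forall>s\<in>index C. \<forall>t\<in>index C. s \<noteq> t \<longrightarrow> 2 \<le> param C s t) \<and>
     bilinear (pairing C) \<and>
     (\<forall>s\<in>index C. pairing C (root1 C s) (root2 C s) = 1) \<and>
     (\<forall>s\<in>index C. \<forall>t\<in>index C. s \<noteq> t \<longrightarrow> pairing C (root1 C s) (root2 C t) \<le> 0) \<and>
     (\<forall>s\<in>index C. \<forall>t\<in>index C.
        case param C s t of
          enat k \<Rightarrow> pairing C (root1 C s) (root2 C t) * pairing C (root1 C t) (root2 C s)
                      = (cos (pi / real k))\<^sup>2
        | \<infinity> \<Rightarrow> (\<exists>g::real. 1 \<le> g \<and>
             pairing C (root1 C s) (root2 C t) * pairing C (root1 C t) (root2 C s) = g\<^sup>2)) \<and>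
     (\<forall>s\<in>index C. \<forall>t\<in>index C.
        pairing C (root1 C s) (root2 C t) = 0 \<longleftrightarrow> pairing C (root1 C t) (root2 C s) = 0) \<and>
     0 \<notin> PLC (root1 C ` index C) \<and> 0 \<notin> PLC (root2 C ` index C)"

text \<open>The abstract Coxeter group: words over $S$ modulo the congruence generated by the defining
  relations. Every generator is an involution, so this monoid presentation is the group
  presentation.\<close>

inductive_set coxeter_cong :: "'s set \<Rightarrow> ('s \<Rightarrow> 's \<Rightarrow> enat) \<Rightarrow> ('s list \<times> 's list) set"
  for S :: "'s set" and m :: "'s \<Rightarrow> 's \<Rightarrow> enat" where
  cong_refl: "u \<in> lists S \<Longrightarrow> (u, u) \<in> coxeter_cong S m"
| cong_sym: "(u, v) \<in> coxeter_cong S m \<Longrightarrow> (v, u) \<in> coxeter_cong S m"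
| cong_trans: "(u, v) \<in> coxeter_cong S m \<Longrightarrow> (v, w) \<in> coxeter_cong S m
    \<Longrightarrow> (u, w) \<in> coxeter_cong S m"
| cong_square: "u \<in> lists S \<Longrightarrow> v \<in> lists S \<Longrightarrow> s \<in> S
    \<Longrightarrow> (u @ [s, s] @ v, u @ v) \<in> coxeter_cong S m"
| cong_braid: "u \<in> lists S \<Longrightarrow> v \<in> lists S \<Longrightarrow> s \<in> S \<Longrightarrow> t \<in> S \<Longrightarrow> m s t = enat k
    \<Longrightarrow> (u @ concat (replicate k [s, t]) @ v, u @ v) \<in> coxeter_cong S m"

definition coxeter_group :: "'s set \<Rightarrow> ('s \<Rightarrow> 's \<Rightarrow> enat) \<Rightarrow> 's list set monoid" where
  "coxeter_group S m =
     \<lparr>carrier = lists S // coxeter_cong S m,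
      mult = (\<lambda>A B. \<Union>u\<in>A. \<Union>v\<in>B. coxeter_cong S m `` {u @ v}),
      one = coxeter_cong S m `` {[]}\<rparr>"

abbreviation W :: "('s, 'a, 'b) coxeter_tuple \<Rightarrow> 's list set monoid" where
  "W C \<equiv> coxeter_group (index C) (param C)"

definition refl1 ::
    "('s, 'a::real_vector, 'b::real_vector) coxeter_tuple \<Rightarrow> 's \<Rightarrow> 'a \<Rightarrow> 'a" where
  "refl1 C s x = x - (2 * pairing C x (root2 C s)) *\<^sub>R root1 C s"

definition refl2 ::
    "('s, 'a::real_vector, 'b::real_vector) coxeter_tuple \<Rightarrow> 's \<Rightarrow> 'b \<Rightarrow> 'b" where
  "refl2 C s y = y - (2 * pairing C (root1 C s) y) *\<^sub>R root2 C s"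

text \<open>An element of $W$ is a class of words and acts through any of its words; all of them act in
  the same way, so that \<^const>\<open>the_elem\<close> is applied to a singleton.\<close>

definition act1 ::
    "('s, 'a::real_vector, 'b::real_vector) coxeter_tuple \<Rightarrow> 's list set \<Rightarrow> 'a \<Rightarrow> 'a" where
  "act1 C w x = the_elem ((\<lambda>u. foldr (refl1 C) u x) ` w)"

definition act2 ::
    "('s, 'a::real_vector, 'b::real_vector) coxeter_tuple \<Rightarrow> 's list set \<Rightarrow> 'b \<Rightarrow> 'b" where
  "act2 C w y = the_elem ((\<lambda>u. foldr (refl2 C) u y) ` w)"

definition Phi1 :: "('s, 'a::real_vector, 'b::real_vector) coxeter_tuple \<Rightarrow> 'a set" where
  "Phi1 C = {act1 C w (root1 C s) | w s. w \<in> carrier (W C) \<and> s \<in> index C}"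

definition Phi2 :: "('s, 'a::real_vector, 'b::real_vector) coxeter_tuple \<Rightarrow> 'b set" where
  "Phi2 C = {act2 C w (root2 C s) | w s. w \<in> carrier (W C) \<and> s \<in> index C}"

definition Phi1_pos :: "('s, 'a::real_vector, 'b::real_vector) coxeter_tuple \<Rightarrow> 'a set" where
  "Phi1_pos C = Phi1 C \<inter> PLC (root1 C ` index C)"

definition phi :: "('s, 'a::real_vector, 'b::real_vector) coxeter_tuple \<Rightarrow> 'a \<Rightarrow> 'b" where
  "phi C = (THE f. f \<in> extensional (Phi1 C) \<and> bij_betw f (Phi1 C) (Phi2 C) \<and>
     (\<forall>w\<in>carrier (W C). \<forall>x\<in>Phi1 C. f (act1 C w x) = act2 C w (f x)) \<and>
     (\<forall>s\<in>index C. f (root1 C s) = root2 C s))"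

text \<open>\<open>b\<close> restricted to \<open>S\<close> is a basis, indexed by \<open>S\<close>, of the whole space.\<close>

definition basis_family :: "'s set \<Rightarrow> ('s \<Rightarrow> 'a::real_vector) \<Rightarrow> bool" where
  "basis_family S b \<longleftrightarrow> inj_on b S \<and> independent (b ` S) \<and> span (b ` S) = UNIV"

definition basis_coeff :: "'s set \<Rightarrow> ('s \<Rightarrow> 'a::real_vector) \<Rightarrow> 'a \<Rightarrow> 's \<Rightarrow> real" where
  "basis_coeff S b v s = representation (b ` S) v (b s)"

text \<open>\<open>C'\<close> is the datum $\mathscr{C}'$ built from bases $\alpha'$, $\beta'$ with the same parameters
  and the same values of the pairing on them.\<close>

definition free_datum :: "('s, 'a::real_vector, 'b::real_vector) coxeter_tuple \<Rightarrow>
    ('s, 'c::real_vector, 'd::real_vector) coxeter_tuple \<Rightarrow> bool" where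
  "free_datum C C' \<longleftrightarrow>
     index C' = index C \<and> param C' = param C \<and>
     basis_family (index C) (root1 C') \<and> basis_family (index C) (root2 C') \<and>
     bilinear (pairing C') \<and>
     (\<forall>s\<in>index C. \<forall>t\<in>index C.
        pairing C' (root1 C' s) (root2 C' t) = pairing C (root1 C s) (root2 C t))"

definition proj1 :: "('s, 'a::real_vector, 'b::real_vector) coxeter_tuple \<Rightarrow>
    ('s, 'c::real_vector, 'd::real_vector) coxeter_tuple \<Rightarrow> 'c \<Rightarrow> 'a" where
  "proj1 C C' = (THE f. linear f \<and> (\<forall>s\<in>index C. f (root1 C' s) = root1 C s))"

definition proj2 :: "('s, 'a::real_vector, 'b::real_vector) coxeter_tuple \<Rightarrow>
    ('s, 'c::real_vector, 'd::real_vector) coxeter_tuple \<Rightarrow> 'd \<Rightarrow> 'b" where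
  "proj2 C C' = (THE f. linear f \<and> (\<forall>s\<in>index C. f (root2 C' s) = root2 C s))"

definition coeff1 :: "('s, 'a::real_vector, 'b::real_vector) coxeter_tuple \<Rightarrow>
    ('s, 'c::real_vector, 'd::real_vector) coxeter_tuple \<Rightarrow> 's \<Rightarrow> 'a \<Rightarrow> real" where
  "coeff1 C C' s z =
     basis_coeff (index C) (root1 C') (THE z'. z' \<in> Phi1 C' \<and> proj1 C C' z' = z) s"

definition coeff2 :: "('s, 'a::real_vector, 'b::real_vector) coxeter_tuple \<Rightarrow>
    ('s, 'c::real_vector, 'd::real_vector) coxeter_tuple \<Rightarrow> 's \<Rightarrow> 'b \<Rightarrow> real" where
  "coeff2 C C' s z =
     basis_coeff (index C) (root2 C') (THE z'. z' \<in> Phi2 C' \<and> proj2 C C' z' = z) s"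

definition supp1 :: "('s, 'a::real_vector, 'b::real_vector) coxeter_tuple \<Rightarrow>
    ('s, 'c::real_vector, 'd::real_vector) coxeter_tuple \<Rightarrow> 'a \<Rightarrow> 'a set" where
  "supp1 C C' x = {root1 C s | s. s \<in> index C \<and> coeff1 C C' s x \<noteq> 0}"

definition supp2 :: "('s, 'a::real_vector, 'b::real_vector) coxeter_tuple \<Rightarrow>
    ('s, 'c::real_vector, 'd::real_vector) coxeter_tuple \<Rightarrow> 'b \<Rightarrow> 'b set" where
  "supp2 C C' y = {root2 C s | s. s \<in> index C \<and> coeff2 C C' s y \<noteq> 0}"

text \<open>The standard geometric realization is recorded as a tuple \<open>G\<close> with $V_1 = V_2 = V$ and
  $\alpha_s = \beta_s = \gamma_s$, whose pairing is the symmetric form. Then \<^term>\<open>act1 G\<close> is the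
  action $r_s v = v - 2 (v, \gamma_s) \gamma_s$ and \<^term>\<open>Phi1 G\<close> is $\Phi$.\<close>

definition standard_realization :: "('s, 'a::real_vector, 'b::real_vector) coxeter_tuple \<Rightarrow>
    ('s, 'v::real_vector, 'v) coxeter_tuple \<Rightarrow> bool" where
  "standard_realization C G \<longleftrightarrow>
     index G = index C \<and> param G = param C \<and> root2 G = root1 G \<and>
     basis_family (index C) (root1 G) \<and>
     bilinear (pairing G) \<and> (\<forall>x y. pairing G x y = pairing G y x) \<and>
     (\<forall>s\<in>index C. pairing G (root1 G s) (root1 G s) = 1) \<and>
     (\<forall>s\<in>index C. \<forall>t\<in>index C. s \<noteq> t \<longrightarrow> pairing G (root1 G s) (root1 G t) \<le> 0) \<and>
     (\<forall>s\<in>index C. \<forall>t\<in>index C. (pairing G (root1 G s) (root1 G t))\<^sup>2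
        = pairing C (root1 C s) (root2 C t) * pairing C (root1 C t) (root2 C s))"

definition phi_std :: "('s, 'a::real_vector, 'b::real_vector) coxeter_tuple \<Rightarrow>
    ('s, 'v::real_vector, 'v) coxeter_tuple \<Rightarrow> 'a \<Rightarrow> 'v" where
  "phi_std C G = (THE f. f \<in> Phi1 C \<rightarrow>\<^sub>E Phi1 G \<and>
     (\<forall>w\<in>carrier (W C). \<forall>x\<in>Phi1 C. f (act1 C w x) = act1 G w (f x)) \<and>
     (\<forall>s\<in>index C. f (root1 C s) = root1 G s))"

definition coeff_std :: "('s, 'v::real_vector, 'v) coxeter_tuple \<Rightarrow> 's \<Rightarrow> 'v \<Rightarrow> real" where
  "coeff_std G s z = basis_coeff (index G) (root1 G) z s"

end

theory Submission
  imports Defs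
begin

text \<open>Write $a$, $b$, $g$ for the coefficients at $t$ of the roots $w\alpha_s$, $w\beta_s$ and $w\gamma_s$ in
the two halves of the free datum and in the standard realization. All assertions are read off from
one property of the triple $(a, b, g)$ or, if the root is negative, of $(-a, -b, -g)$. Call a triple
\<open>admissible\<close> if it is zero, or if $a, b > 0$ and either $ab \ge 4$ and $g \ge 2$, or $ab = g^2$ with
$g = 1$ or $g = 2\cos(\pi/m)$ for a finite parameter $m \ge 4$.

The point of this definition is that admissible triples are closed under componentwise addition and
multiplication (\<open>admissible_add\<close>, \<open>admissible_mult\<close>). For two nonzero triples
$ab \ge 1$ and $a'b' \ge 1$, so that $ab' + a'b \ge 2$ and hence $(a+a')(b+b') \ge 4$: a genuine sum
always lands in the range where nothing more has to be known. A product of two values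
$2\cos(\pi/m)$ with $m \ge 4$ is at least $\sqrt 2 \cdot \sqrt 2 = 2$.

Admissibility of all positive roots is then proved by the induction on length with which Tits shows
that every root is positive or negative, so that this dichotomy is obtained along the way
(\<open>admissible_if_ascent\<close>). If $\ell(ws) > \ell(w)$ and $w \ne 1$, take $r$ with
$\ell(wr) < \ell(w)$ and split off the longest alternating word in $r, s$ (\<open>dihedral_decomposition\<close>):
$w = vu$, where $v$ is shorter than $w$ and lengthened by both $r$ and $s$, and $u$ has fewer than
$m_{rs}$ letters. Then $w\alpha_s = v(u\alpha_s)$ is a combination of $v\alpha_r$ and $v\alpha_s$, to
which the induction hypothesis applies, and its two coefficients are those of a root of rank two.

In rank two the three realizations differ only by a change of scale: replacing $\alpha_r$ by
$\lambda\alpha_r$ and $\beta_r$ by $\lambda^{-1}\beta_r$ for a suitable $\lambda > 0$ makes the pairing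
symmetric (\<open>gauge\<close>). The coefficients of $u\alpha_s$, $u\beta_s$, $u\gamma_s$ are therefore
$(U, U, U)$ at $s$ and $(\lambda U, \lambda^{-1} U, U)$ at $r$, where $U$ is a Chebyshev number
$\sin(k\theta)/\sin\theta$ with $\theta = \pi/m_{rs}$ and $k \le m_{rs}$ (or a number that grows with $k$
by at least one in each step if $m_{rs} = \infty$). Such a $U$ is $0$, $1$, $2\cos\theta$ or at least $2$.

It remains to see that the maps in question send the root of a word to the root of the same word.
If $w\alpha_s = \alpha_t$ in the free datum, then admissibility leaves only the coefficients at $t$ in
$w\beta_s$ and $w\gamma_s$, and invariance of the pairings forces them to be $1$
(\<open>simple_root_simultaneously\<close>). Roots of the given datum correspond to those of the free one because
a root, having coefficients of one sign, cannot project to a simple root unless it is that simple root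
(\<open>simple_root_relation_trivial\<close>).\<close>

section \<open>Rank two: alternating words and Chebyshev numbers\<close>

text \<open>The values at $q/2$ of the Chebyshev polynomials of the second kind, with indices shifted by one so
that $k$ matches $\sin(k\theta)/\sin\theta$.\<close>

fun cheb :: "real \<Rightarrow> nat \<Rightarrow> real" where
  "cheb q 0 = 0"
| "cheb q (Suc 0) = 1"
| "cheb q (Suc (Suc k)) = q * cheb q (Suc k) - cheb q k"

lemma cheb_sin: "sin \<theta> * cheb (2 * cos \<theta>) k = sin (real k * \<theta>)"
proof (induction "2 * cos \<theta>" k rule: cheb.induct)
  case (3 k)
  have "sin (real (Suc (Suc k)) * \<theta>) + sin (real k * \<theta>)
      = 2 * cos \<theta> * sin (real (Suc k) * \<theta>)"
    using sin_add[of "real (Suc k) * \<theta>" \<theta>] sin_diff[of "real (Suc k) * \<theta>" \<theta>]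
    by (simp add: algebra_simps)
  then show ?case
    using 3 by (simp add: algebra_simps)
qed auto

lemma cheb_increasing:
  assumes "2 \<le> q"
  shows "0 \<le> cheb q k \<and> cheb q k + 1 \<le> cheb q (Suc k)"
proof (induction k)
  case (Suc k)
  have "2 * cheb q (Suc k) \<le> q * cheb q (Suc k)"
    using Suc assms by (intro mult_right_mono) auto
  then show ?case
    unfolding cheb.simps using Suc by linarith
qed auto

text \<open>The last letter is the fixed one because words act through \<^const>\<open>foldr\<close>: it is the first to act
on a vector.\<close>

fun alt :: "'s \<Rightarrow> 's \<Rightarrow> nat \<Rightarrow> 's list" where
  "alt r s 0 = []"
| "alt r s (Suc k) = alt s r k @ [r]"

lemma length_alt [simp]: "length (alt r s k) = k"
  by (induction r s k rule: alt.induct) auto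

lemma alt_in_lists: "r \<in> S \<Longrightarrow> s \<in> S \<Longrightarrow> alt r s k \<in> lists S"
  by (induction r s k rule: alt.induct) auto

lemma alt_Cons: "alt r s (Suc k) = (if even k then r else s) # alt r s k"
  by (induction r s k rule: alt.induct) auto

lemma drop_alt: "drop i (alt r s (i + j)) = alt r s j"
  by (induction r s j rule: alt.induct) auto

lemma concat_replicate_eq_alt: "concat (replicate k [s, t]) = alt t s (2 * k)"
  by (induction k) (auto simp: alt_Cons simp del: alt.simps(2))

lemma linear_foldr:
  assumes "\<And>s. s \<in> S \<Longrightarrow> linear (R s)" and "u \<in> lists S"
  shows "linear (foldr R u)"
  using assms(2)
proof (induction u)
  case Nil
  then show ?case by (simp add: linear_id[unfolded id_def] id_def)
next
  case (Cons a u)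
  then show ?case
    using linear_compose[of "foldr R u" "R a"] assms(1)[of a] by (simp add: o_def comp_def)
qed

text \<open>The hypotheses describe a symmetric rank-two system $x, y$. The recursion peels off the letter
that acts first: $u r x = u x + q\,u y$, and in $ux$ the next letter only changes the sign of $x$. This
is the Chebyshev recursion for both families of vectors at once, and so the induction must allow the
two roots to be exchanged.\<close>

lemma foldr_alt:
  assumes "linear (R r)" "linear (R s)"
    and "R s x = - x" "R r y = - y"
    and "R r x = x + q *\<^sub>R y" "R s y = y + q *\<^sub>R x"
  shows "foldr R (alt r s k) x =
    cheb q (Suc k) *\<^sub>R (if even k then x else y) + cheb q k *\<^sub>R (if even k then y else x)"
  using assms
proof (induction k arbitrary: r s x y rule: less_induct)
  case (less k)
  note R = less.prems
  consider "k = 0" | "k = Suc 0" | j where "k = Suc (Suc j)"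
    by (metis not0_implies_Suc)
  then show ?case
  proof cases
    case 3
    have lin: "linear (foldr R (alt s r (Suc j)))"
      by (rule linear_foldr[OF _ alt_in_lists[of s "{r, s}" r]]) (use R(1,2) in auto)
    have linj: "linear (foldr R (alt r s j))"
      by (rule linear_foldr[OF _ alt_in_lists[of r "{r, s}" s]]) (use R(1,2) in auto)
    have "foldr R (alt r s k) x = foldr R (alt s r (Suc j)) (x + q *\<^sub>R y)"
      using R(5) by (simp add: 3)
    also have "\<dots> = foldr R (alt s r (Suc j)) x + q *\<^sub>R foldr R (alt s r (Suc j)) y"
      using lin by (simp add: linear_add linear_scale del: alt.simps)
    also have "foldr R (alt s r (Suc j)) x = - foldr R (alt r s j) x"
      using R(3) linj by (simp add: linear_neg)
    finally have rec: "foldr R (alt r s k) x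
        = - foldr R (alt r s j) x + q *\<^sub>R foldr R (alt s r (Suc j)) y" .
    have e1: "foldr R (alt r s j) x =
        cheb q (Suc j) *\<^sub>R (if even j then x else y) + cheb q j *\<^sub>R (if even j then y else x)"
      by (rule less.IH) (use R 3 in auto)
    have e2: "foldr R (alt s r (Suc j)) y =
        cheb q (Suc (Suc j)) *\<^sub>R (if even (Suc j) then y else x)
        + cheb q (Suc j) *\<^sub>R (if even (Suc j) then x else y)"
      by (rule less.IH) (use R 3 in auto)
    show ?thesis
      unfolding rec e1 e2 by (simp add: 3 algebra_simps)
  qed (use R in auto)
qed

section \<open>Coxeter words and their length\<close>

lemma concat_replicate_in_lists: "s \<in> S \<Longrightarrow> t \<in> S \<Longrightarrow> concat (replicate k [s, t]) \<in> lists S"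
  by (simp add: concat_replicate_eq_alt alt_in_lists)

lemma coxeter_cong_in_lists:
  "(u, v) \<in> coxeter_cong S m \<Longrightarrow> u \<in> lists S \<and> v \<in> lists S"
  by (induction rule: coxeter_cong.induct) (auto dest: concat_replicate_in_lists)

lemma coxeter_cong_context:
  assumes "(u, v) \<in> coxeter_cong S m" "p \<in> lists S" "q \<in> lists S"
  shows "(p @ u @ q, p @ v @ q) \<in> coxeter_cong S m"
  using assms
proof (induction rule: coxeter_cong.induct)
  case (cong_square u v s)
  then show ?case
    using coxeter_cong.cong_square[of "p @ u" S "v @ q" s m] by simp
next
  case (cong_braid u v s t k)
  then show ?case
    using coxeter_cong.cong_braid[of "p @ u" S "v @ q" s t m k] by simp
next
  case (cong_refl u)
  then show ?case
    by (intro coxeter_cong.cong_refl) auto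
qed (blast intro: coxeter_cong.intros)+

lemma rev_in_lists: "u \<in> lists S \<Longrightarrow> rev u \<in> lists S"
  by auto

lemma coxeter_cong_append_rev:
  "u \<in> lists S \<Longrightarrow> (u @ rev u, []) \<in> coxeter_cong S m"
proof (induction u rule: rev_induct)
  case (snoc s u)
  then have "(u @ [s, s] @ rev u, u @ rev u) \<in> coxeter_cong S m"
    by (intro coxeter_cong.cong_square) auto
  with snoc show ?case
    by (auto intro: coxeter_cong.cong_trans)
qed (auto intro: coxeter_cong.intros)

lemma coxeter_cong_cancel:
  assumes "w \<in> lists S" "u \<in> lists S"
  shows "(w @ u @ rev u, w) \<in> coxeter_cong S m" "(w @ rev u @ u, w) \<in> coxeter_cong S m"
  using coxeter_cong_context[OF coxeter_cong_append_rev[of u S m], of w "[]"]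
    coxeter_cong_context[OF coxeter_cong_append_rev[of "rev u" S m], of w "[]"] assms rev_in_lists[OF assms(2)]
  by (auto simp del: in_lists_conv_set)

lemma coxeter_cong_left_inverse:
  assumes "(u @ v, []) \<in> coxeter_cong S m"
  shows "(v, rev u) \<in> coxeter_cong S m"
proof -
  have uv: "u \<in> lists S" "v \<in> lists S"
    using coxeter_cong_in_lists[OF assms] by auto
  then have "(rev u @ u @ v, v) \<in> coxeter_cong S m"
    using coxeter_cong_context[OF coxeter_cong_append_rev[of "rev u" S m], of "[]" v] rev_in_lists[of u S]
    by (auto simp del: in_lists_conv_set)
  moreover have "(rev u @ u @ v, rev u) \<in> coxeter_cong S m"
    using coxeter_cong_context[OF assms, of "rev u" "[]"] rev_in_lists[OF uv(1)]
    by (auto simp del: in_lists_conv_set)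
  ultimately show ?thesis
    by (blast intro: coxeter_cong.intros)
qed

text \<open>All defining relators have even length. This is what makes right multiplication by a generator
change the length.\<close>

lemma coxeter_cong_parity:
  "(u, v) \<in> coxeter_cong S m \<Longrightarrow> even (length u) = even (length v)"
  by (induction rule: coxeter_cong.induct) (auto simp: concat_replicate_eq_alt)

lemma foldr_coxeter_cong:
  assumes "(u, v) \<in> coxeter_cong S m"
    and "\<And>s x. s \<in> S \<Longrightarrow> R s (R s x) = x"
    and "\<And>s t k x. s \<in> S \<Longrightarrow> t \<in> S \<Longrightarrow> m s t = enat k \<Longrightarrow>
      foldr R (concat (replicate k [s, t])) x = x"
  shows "foldr R u x = foldr R v x"
  using assms(1) by (induction arbitrary: x rule: coxeter_cong.induct) (simp_all add: assms(2,3))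

definition wlen :: "'s set \<Rightarrow> ('s \<Rightarrow> 's \<Rightarrow> enat) \<Rightarrow> 's list \<Rightarrow> nat" where
  "wlen S m u = (LEAST n. \<exists>v. (u, v) \<in> coxeter_cong S m \<and> length v = n)"

lemma wlen_le: "(u, v) \<in> coxeter_cong S m \<Longrightarrow> wlen S m u \<le> length v"
  unfolding wlen_def by (rule Least_le) blast

lemma reduced_word_exists:
  assumes "u \<in> lists S"
  obtains v where "(u, v) \<in> coxeter_cong S m" "length v = wlen S m u"
proof -
  have "\<exists>n v. (u, v) \<in> coxeter_cong S m \<and> length v = n"
    using coxeter_cong.cong_refl[OF assms] by blast
  from LeastI_ex[OF this] show thesis
    using that unfolding wlen_def by blast
qed

lemma wlen_cong:
  assumes "(u, v) \<in> coxeter_cong S m"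
  shows "wlen S m u = wlen S m v"
proof -
  have "(u, x) \<in> coxeter_cong S m \<longleftrightarrow> (v, x) \<in> coxeter_cong S m" for x
    using assms by (blast intro: coxeter_cong.intros)
  then show ?thesis
    by (simp add: wlen_def)
qed

lemma wlen_append_le:
  assumes "u \<in> lists S" "v \<in> lists S"
  shows "wlen S m (u @ v) \<le> wlen S m u + length v"
proof -
  obtain u' where "(u, u') \<in> coxeter_cong S m" "length u' = wlen S m u"
    using reduced_word_exists[OF assms(1)] .
  then show ?thesis
    using wlen_le[OF coxeter_cong_context[of u u' S m "[]" v]] assms by auto
qed

lemma wlen_parity:
  assumes "u \<in> lists S"
  shows "even (wlen S m u) = even (length u)"
  using reduced_word_exists[OF assms] coxeter_cong_parity by metis

lemma wlen_snoc:
  assumes "u \<in> lists S" "s \<in> S"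
  shows "wlen S m (u @ [s]) = wlen S m u + 1 \<or> wlen S m u = wlen S m (u @ [s]) + 1"
proof -
  have "wlen S m (u @ [s] @ [s]) = wlen S m u"
    using wlen_cong[OF coxeter_cong_cancel(1)[of u S "[s]"]] assms by simp
  then have "wlen S m u \<le> wlen S m (u @ [s]) + 1"
    using wlen_append_le[of "u @ [s]" S "[s]" m] assms by simp
  moreover have "wlen S m (u @ [s]) \<le> wlen S m u + 1"
    using wlen_append_le[of u S "[s]" m] assms by simp
  moreover have "wlen S m (u @ [s]) \<noteq> wlen S m u"
    using wlen_parity[of u S m] wlen_parity[of "u @ [s]" S m] assms by auto
  ultimately show ?thesis
    by linarith
qed

text \<open>The alternating word with $2n$ letters is trivial; its last $n + 1$ letters are therefore inverse to
its first $n - 1$ letters.\<close>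

lemma long_alt_shortens:
  assumes "r \<in> S" "s \<in> S" "m r s = enat n" "0 < n"
  obtains z where "(alt s r (n + 1), z) \<in> coxeter_cong S m" "length z = n - 1"
proof -
  have "drop (n - 1) (alt s r (2 * n)) = alt s r (n + 1)"
    using drop_alt[of "n - 1" s r "n + 1"] assms(4) by (simp add: mult_2 del: alt.simps)
  then have split: "alt s r (2 * n) = take (n - 1) (alt s r (2 * n)) @ alt s r (n + 1)"
    by (metis append_take_drop_id)
  have "(alt s r (2 * n), []) \<in> coxeter_cong S m"
    using coxeter_cong.cong_braid[of "[]" S "[]" r s m n] assms
    by (simp add: concat_replicate_eq_alt del: alt.simps)
  then show thesis
    using that[OF coxeter_cong_left_inverse[of "take (n - 1) (alt s r (2 * n))"]] split assms(4)
    by (simp del: alt.simps)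
qed

text \<open>The decomposition of $w$ with respect to the right coset of the rank-two subgroup generated by
$r$ and $s$. Multiplying $w$ on the right by $r, s, r, \dots$ as long as each letter shortens it leads to
$v$. The bound on the number $k$ of letters uses that $s$ lengthens $w$: with $k \ge m_{rs}$ letters,
the word $u s$, which alternates too, could be shortened below the length of $u$.\<close>

lemma dihedral_decomposition:
  assumes w: "w \<in> lists S" and rs: "r \<in> S" "s \<in> S" and m0: "m r s \<noteq> 0"
    and desc: "wlen S m (w @ [r]) < wlen S m w" and asc: "wlen S m w < wlen S m (w @ [s])"
  obtains v k where "v \<in> lists S" "(w, v @ alt r s k) \<in> coxeter_cong S m"
    "wlen S m v < wlen S m w"
    "wlen S m v < wlen S m (v @ [r])" "wlen S m v < wlen S m (v @ [s])"
    "\<And>n. m r s = enat n \<Longrightarrow> k < n"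
proof -
  let ?l = "wlen S m"
  let ?P = "\<lambda>k. ?l (w @ rev (alt r s k)) + k = ?l w"
  define k where "k = (GREATEST k. ?P k)"
  have bound: "\<And>j. ?P j \<Longrightarrow> j \<le> ?l w"
    by linarith
  \<comment> \<open>The first \<open>k\<close> letters all shorten \<open>w\<close>; there are at most as many as the length of \<open>w\<close>.\<close>
  have P1: "?P 1"
    using wlen_snoc[OF w rs(1), of m] desc by simp
  have Pk: "?P k"
    unfolding k_def by (rule GreatestI_nat[of "?P" 1 "?l w"]) (use P1 bound in auto)
  have k_max: "\<And>j. ?P j \<Longrightarrow> j \<le> k"
    unfolding k_def by (rule Greatest_le_nat[of "?P" _ "?l w"]) (use bound in auto)
  have alts: "alt r s j \<in> lists S" for j
    using rs by (rule alt_in_lists)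
  define v where "v = w @ rev (alt r s k)"
  have v: "v \<in> lists S"
    using w alts[of k] by (auto simp: v_def)
  have wv: "(w, v @ alt r s k) \<in> coxeter_cong S m"
    using coxeter_cong_cancel(2)[OF w alts[of k], of m]
    by (auto simp: v_def intro: coxeter_cong.cong_sym)
  have lv: "?l v + k = ?l w"
    using Pk by (simp add: v_def)
  have k1: "1 \<le> k"
    using k_max[OF P1] .
  have up: "?l v < ?l (v @ [if even k then r else s])"
  proof -
    have "\<not> ?P (Suc k)"
      using k_max[of "Suc k"] by auto
    then have "?l (v @ [if even k then r else s]) + Suc k \<noteq> ?l w"
      by (simp add: alt_Cons v_def del: alt.simps)
    then show ?thesis
      using wlen_snoc[OF v, of "if even k then r else s" m] rs lv by auto
  qed
  \<comment> \<open>Multiplying by the letter that was split off last undoes the last step from \<open>w\<close> to \<open>v\<close>.\<close>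
  have down: "?l v < ?l (v @ [if even k then s else r])"
  proof -
    obtain j where j: "k = Suc j"
      using k1 by (cases k) auto
    let ?y = "if even k then s else r"
    let ?w = "w @ rev (alt r s j)"
    have w': "?w \<in> lists S"
      using w alts[of j] by auto
    have vj: "v = ?w @ [?y]"
      by (simp add: v_def j alt_Cons del: alt.simps)
    have "?l (v @ [?y]) = ?l ?w"
      using wlen_cong[OF coxeter_cong_cancel(1)[OF w', of "[?y]" m]] rs vj by simp
    moreover have "?l w \<le> ?l ?w + j"
      using wlen_append_le[OF w' alts[of j], of m] wlen_cong[OF coxeter_cong_cancel(2)[OF w alts[of j], of m]]
      by simp
    ultimately show ?thesis
      using lv j by linarith
  qed
  have "k < n" if n: "m r s = enat n" for n
  proof (rule ccontr)
    assume "\<not> k < n"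
    then have nk: "n \<le> k" by simp
    have n0: "0 < n"
      using m0 n by (cases n) (auto simp: zero_enat_def)
    obtain z where z: "(alt s r (n + 1), z) \<in> coxeter_cong S m" "length z = n - 1"
      using long_alt_shortens[of r S s m n] rs n n0 by blast
    define p where "p = take (k - n) (alt s r (k + 1))"
    have sp: "alt s r (k + 1) = p @ alt s r (n + 1)"
      using append_take_drop_id[of "k - n" "alt s r (k + 1)"] drop_alt[of "k - n" s r "n + 1"] nk
      by (simp add: p_def del: append_take_drop_id alt.simps)
    have "p @ alt s r (n + 1) \<in> lists S"
      using alt_in_lists[OF rs(2,1), of "k + 1"] sp by (simp del: alt.simps)
    then have p: "p \<in> lists S" by simp
    have "(w @ [s], v @ alt s r (k + 1)) \<in> coxeter_cong S m"
      using coxeter_cong_context[OF wv, of "[]" "[s]"] rs by simp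
    moreover have "(v @ alt s r (k + 1), v @ p @ z) \<in> coxeter_cong S m"
      using coxeter_cong_context[OF z(1), of "v @ p" "[]"] v p sp by (simp del: alt.simps)
    ultimately have "?l (w @ [s]) = ?l (v @ p @ z)"
      using wlen_cong by metis
    also have "\<dots> \<le> ?l v + length (p @ z)"
      using p coxeter_cong_in_lists[OF z(1)] by (intro wlen_append_le v) auto
    also have "\<dots> < ?l w"
      using lv nk n0 z(2) by (simp add: p_def)
    finally show False
      using asc by simp
  qed
  moreover have "?l v < ?l (v @ [r])" "?l v < ?l (v @ [s])"
    using up down by (auto split: if_splits)
  ultimately show thesis
    using that[OF v wv] lv k1 by simp
qed

section \<open>Admissible coefficient triples\<close>

text \<open>For $m = 3$ the number $2\cos(\pi/m)$ is $1$, and for $m = 2$ it vanishes; these cases are left to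
the first alternative and to the zero triple.\<close>

definition dihedral_value :: "'s set \<Rightarrow> ('s \<Rightarrow> 's \<Rightarrow> enat) \<Rightarrow> real \<Rightarrow> bool" where
  "dihedral_value S m g \<longleftrightarrow>
     g = 1 \<or> (\<exists>r\<in>S. \<exists>s\<in>S. \<exists>k. m r s = enat k \<and> 4 \<le> k \<and> g = 2 * cos (pi / real k))"

definition admissible :: "'s set \<Rightarrow> ('s \<Rightarrow> 's \<Rightarrow> enat) \<Rightarrow> real \<Rightarrow> real \<Rightarrow> real \<Rightarrow> bool" where
  "admissible S m a b g \<longleftrightarrow>
     a = 0 \<and> b = 0 \<and> g = 0 \<or>
     0 < a \<and> 0 < b \<and> (4 \<le> a * b \<and> 2 \<le> g \<or> a * b = g\<^sup>2 \<and> dihedral_value S m g)"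

lemma two_cos_bounds:
  assumes "4 \<le> (k::nat)"
  shows "1 \<le> 2 * cos (pi / real k)" "2 \<le> (2 * cos (pi / real k))\<^sup>2"
proof -
  have "cos (pi / 4) \<le> cos (pi / real k)"
    using assms by (intro cos_monotone_0_pi_le) (auto simp: field_simps)
  then have le: "sqrt 2 \<le> 2 * cos (pi / real k)"
    by (simp add: cos_45)
  have "1 \<le> sqrt 2" by simp
  with le show "1 \<le> 2 * cos (pi / real k)" by linarith
  have "(sqrt 2)\<^sup>2 \<le> (2 * cos (pi / real k))\<^sup>2"
    using le by (intro power_mono) auto
  then show "2 \<le> (2 * cos (pi / real k))\<^sup>2" by simp
qed

lemma dihedral_value_cases:
  assumes "dihedral_value S m g"
  shows "g = 1 \<or> 1 \<le> g \<and> 2 \<le> g\<^sup>2"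
  using assms two_cos_bounds unfolding dihedral_value_def by blast

lemma admissible_zero [simp]: "admissible S m 0 0 0"
  by (simp add: admissible_def)

lemma admissible_scale: "0 < l \<Longrightarrow> admissible S m l (1 / l) 1"
  by (simp add: admissible_def dihedral_value_def)

lemma admissible_nonzero:
  assumes "admissible S m a b g" "a \<noteq> 0 \<or> b \<noteq> 0 \<or> g \<noteq> 0"
  shows "0 < a" "0 < b" "1 \<le> g" "1 \<le> a * b"
proof -
  have *: "0 < a \<and> 0 < b \<and> (4 \<le> a * b \<and> 2 \<le> g \<or> a * b = g\<^sup>2 \<and> dihedral_value S m g)"
    using assms unfolding admissible_def by blast
  then show "0 < a" "0 < b" by auto
  show g: "1 \<le> g"
    using * dihedral_value_cases by fastforce
  show "1 \<le> a * b"
    using * g power_mono[of 1 g 2] by auto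
qed

text \<open>The cross terms decide: $(ab' + a'b)^2 \ge 4\,(ab)(a'b') \ge 4$.\<close>

lemma admissible_add:
  assumes 1: "admissible S m a b g" and 2: "admissible S m a' b' g'"
  shows "admissible S m (a + a') (b + b') (g + g')"
proof (cases "(a = 0 \<and> b = 0 \<and> g = 0) \<or> (a' = 0 \<and> b' = 0 \<and> g' = 0)")
  case True
  then show ?thesis
    using 1 2 by auto
next
  case False
  note n1 = admissible_nonzero[OF 1] and n2 = admissible_nonzero[OF 2]
  have pos: "0 < a" "0 < b" "0 < a'" "0 < b'" and ge: "1 \<le> a * b" "1 \<le> a' * b'" "1 \<le> g" "1 \<le> g'"
    using False n1 n2 by auto
  have "4 * (1 * 1) \<le> 4 * ((a * b) * (a' * b'))"
    using ge by (intro mult_left_mono mult_mono) auto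
  also have "\<dots> \<le> (a * b' + a' * b)\<^sup>2"
    using sum_squares_ge_zero[of "a * b' - a' * b" 0] by (simp add: power2_eq_square algebra_simps)
  finally have "2\<^sup>2 \<le> (a * b' + a' * b)\<^sup>2"
    by simp
  then have "2 \<le> a * b' + a' * b"
    by (rule power2_le_imp_le) (use pos in simp)
  then have "4 \<le> (a + a') * (b + b')"
    using ge by (simp add: algebra_simps)
  then show ?thesis
    using pos ge by (simp add: admissible_def)
qed

text \<open>If one triple is of the large kind, so is the product; if one has $g = 1$, the product is of the kind
of the other; in the remaining case $g^2 \ge 2$ and $g'^2 \ge 2$.\<close>

lemma admissible_mult:
  assumes 1: "admissible S m a b g" and 2: "admissible S m a' b' g'"
  shows "admissible S m (a * a') (b * b') (g * g')"
proof (cases "(a = 0 \<and> b = 0 \<and> g = 0) \<or> (a' = 0 \<and> b' = 0 \<and> g' = 0)")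
  case True
  then show ?thesis
    by auto
next
  case False
  note n1 = admissible_nonzero[OF 1] and n2 = admissible_nonzero[OF 2]
  have pos: "0 < a" "0 < b" "0 < a'" "0 < b'" and ge: "1 \<le> a * b" "1 \<le> a' * b'" "1 \<le> g" "1 \<le> g'"
    using False n1 n2 by auto
  have shuffle: "(a * a') * (b * b') = (a * b) * (a' * b')"
    by (simp add: algebra_simps)
  have "4 \<le> (a * b) * (a' * b') \<and> 2 \<le> g * g'
      \<or> (a * b) * (a' * b') = (g * g')\<^sup>2 \<and> dihedral_value S m (g * g')"
  proof -
    consider "4 \<le> a * b" "2 \<le> g" | "4 \<le> a' * b'" "2 \<le> g'"
      | "a * b = g\<^sup>2" "dihedral_value S m g" "a' * b' = g'\<^sup>2" "dihedral_value S m g'"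
      using 1 2 False unfolding admissible_def by auto
    then show ?thesis
    proof cases
      case 1
      then show ?thesis
        using mult_mono[of 4 "a * b" 1 "a' * b'"] mult_mono[of 2 g 1 g'] ge by auto
    next
      case 2
      then show ?thesis
        using mult_mono[of 1 "a * b" 4 "a' * b'"] mult_mono[of 1 g 2 g'] ge by auto
    next
      case 3
      show ?thesis
      proof (cases "g = 1 \<or> g' = 1")
        case True
        then show ?thesis using 3 by auto
      next
        case False
        then have sq: "2 \<le> g\<^sup>2" "2 \<le> g'\<^sup>2"
          using 3 dihedral_value_cases by blast+
        then have "2 * 2 \<le> g\<^sup>2 * g'\<^sup>2"
          by (intro mult_mono) auto
        then have four: "2\<^sup>2 \<le> (g * g')\<^sup>2"
          by (simp add: power_mult_distrib)
        then have "2 \<le> g * g'"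
          by (rule power2_le_imp_le) (use ge in simp)
        with four show ?thesis
          using 3 by (simp add: power_mult_distrib)
      qed
    qed
  qed
  then show ?thesis
    using pos by (simp add: admissible_def shuffle)
qed

lemma admissible_diag:
  assumes "g = 0 \<or> dihedral_value S m g \<or> 2 \<le> g"
  shows "admissible S m g g g"
  using assms
proof (elim disjE)
  assume g: "dihedral_value S m g"
  then have "1 \<le> g"
    using dihedral_value_cases by fastforce
  with g show ?thesis
    by (simp add: admissible_def power2_eq_square)
next
  assume "2 \<le> g"
  then show ?thesis
    using mult_mono[of 2 g 2 g] by (simp add: admissible_def)
qed simp

text \<open>By the symmetry $j \mapsto n - j$ and monotonicity on $[0, \pi/2]$ it is enough to take $j = 3$, where
$\sin 3\theta = (3 - 4\sin^2\theta)\sin\theta$ and $\sin\theta \le 1/2$ because $n \ge 6$.\<close>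

lemma sin_ratio_ge_two:
  assumes "3 \<le> j" "j + 3 \<le> n"
  shows "2 * sin (pi / real n) \<le> sin (real j * (pi / real n))"
proof -
  define \<theta> where "\<theta> = pi / real n"
  have n: "6 \<le> n" using assms by simp
  have \<theta>: "0 < \<theta>" "\<theta> \<le> pi / 6" "real n * \<theta> = pi"
    using n by (auto simp: \<theta>_def field_simps)
  have s: "0 \<le> sin \<theta>" "sin \<theta> \<le> 1 / 2"
  proof -
    show "0 \<le> sin \<theta>" using \<theta> pi_gt_zero by (intro sin_ge_zero) linarith+
    have "sin \<theta> \<le> sin (pi / 6)"
      using \<theta> pi_gt_zero by (intro sin_monotone_2pi_le) linarith+
    then show "sin \<theta> \<le> 1 / 2" by (simp add: sin_30)
  qed
  have sin3: "2 * sin \<theta> \<le> sin (3 * \<theta>)"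
  proof -
    have "(sin \<theta>)\<^sup>2 \<le> (1 / 2)\<^sup>2"
      using s by (intro power_mono) auto
    then have "sin \<theta> * (2 + 4 * (sin \<theta>)\<^sup>2 - 3) \<le> 0"
      using s by (intro mult_nonneg_nonpos) (auto simp: power2_eq_square)
    moreover have "sin (3 * \<theta>) = 3 * sin \<theta> - 4 * (sin \<theta>) ^ 3"
    proof -
      have "sin (3 * \<theta>) = sin (2 * \<theta> + \<theta>)" by simp
      also have "\<dots> = 2 * sin \<theta> * (cos \<theta>)\<^sup>2 + (1 - 2 * (sin \<theta>)\<^sup>2) * sin \<theta>"
        unfolding sin_add sin_double cos_double_sin by (simp add: power2_eq_square)
      also have "(cos \<theta>)\<^sup>2 = 1 - (sin \<theta>)\<^sup>2"
        by (rule cos_squared_eq)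
      finally show ?thesis
        by (simp add: algebra_simps power2_eq_square power3_eq_cube)
    qed
    ultimately show ?thesis
      by (simp add: algebra_simps power3_eq_cube power2_eq_square)
  qed
  have mono: "sin (3 * \<theta>) \<le> sin (real i * \<theta>)" if "3 \<le> i" "2 * i \<le> n" for i
  proof -
    have "3 * \<theta> \<le> real i * \<theta>" "2 * (real i * \<theta>) \<le> pi"
      using that \<theta> mult_right_mono[of "2 * real i" "real n" \<theta>] by auto
    then show ?thesis
      using \<theta> pi_gt_zero by (intro sin_monotone_2pi_le) linarith+
  qed
  have "sin (3 * \<theta>) \<le> sin (real j * \<theta>)"
  proof (cases "2 * j \<le> n")
    case True
    then show ?thesis using mono assms by blast
  next
    case False
    have "real (n - j) * \<theta> = pi - real j * \<theta>"
      using assms \<theta>(3) by (simp add: of_nat_diff algebra_simps)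
    then have "sin (real (n - j) * \<theta>) = sin (real j * \<theta>)"
      by simp
    then show ?thesis using mono[of "n - j"] False assms by simp
  qed
  with sin3 show ?thesis
    by (simp add: \<theta>_def)
qed

lemma cheb_finite_values:
  assumes "2 \<le> n" "j \<le> n" and m: "r \<in> S" "s \<in> S" "m r s = enat n"
  defines "c \<equiv> cheb (2 * cos (pi / real n)) j"
  shows "c = 0 \<or> dihedral_value S m c \<or> 2 \<le> c"
proof -
  define \<theta> where "\<theta> = pi / real n"
  have "\<theta> < pi" "0 < \<theta>"
    using assms(1) by (auto simp: \<theta>_def field_simps)
  then have s0: "0 < sin \<theta>"
    by (intro sin_gt_zero)
  have n\<theta>: "real n * \<theta> = pi"
    using assms(1) by (simp add: \<theta>_def)
  have c: "sin \<theta> * c = sin (real j * \<theta>)"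
    by (simp add: c_def \<theta>_def cheb_sin)
  have sym: "sin (real (n - i) * \<theta>) = sin (real i * \<theta>)" if "i \<le> n" for i
  proof -
    have "real (n - i) * \<theta> = pi - real i * \<theta>"
      using that n\<theta> by (simp add: of_nat_diff algebra_simps)
    then show ?thesis by simp
  qed
  consider "j = 0 \<or> j = n" | "j = 1 \<or> j = n - 1" | "j = 2 \<or> j = n - 2" | "3 \<le> j" "j + 3 \<le> n"
    using assms(1,2) by linarith
  then show ?thesis
  proof cases
    case 1
    then have "sin \<theta> * c = 0"
      using c n\<theta> by auto
    then show ?thesis using s0 by auto
  next
    case 2
    then have "sin \<theta> * c = sin \<theta>"
      using c sym[of 1] assms(1) by auto
    then show ?thesis using s0 by (auto simp: dihedral_value_def)
  next
    case 3
    then have "sin \<theta> * c = sin (2 * \<theta>)"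
      using c sym[of 2] assms(1) by auto
    then have c2: "c = 2 * cos \<theta>"
      using s0 by (simp add: sin_double)
    consider "n = 2" | "n = 3" | "4 \<le> n" using assms(1) by linarith
    then show ?thesis
    proof cases
      assume "n = 2"
      then show ?thesis using c2 by (simp add: \<theta>_def)
    next
      assume "n = 3"
      then show ?thesis using c2 by (simp add: \<theta>_def cos_60 dihedral_value_def)
    next
      assume "4 \<le> n"
      then show ?thesis using c2 m unfolding \<theta>_def dihedral_value_def by blast
    qed
  next
    case 4
    then have "sin \<theta> * 2 \<le> sin \<theta> * c"
      using sin_ratio_ge_two[OF 4] c by (simp add: \<theta>_def)
    then show ?thesis using s0 by simp
  qed
qed

lemma cheb_infinite_values:
  assumes "2 \<le> q"
  shows "cheb q j = 0 \<or> cheb q j = 1 \<or> 2 \<le> cheb q j"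
proof -
  consider "j = 0" | "j = Suc 0" | i where "j = Suc (Suc i)"
    by (metis not0_implies_Suc)
  then show ?thesis
  proof cases
    case 3
    show ?thesis
      unfolding 3 using cheb_increasing[OF assms, of i] cheb_increasing[OF assms, of "Suc i"] by linarith
  qed auto
qed

section \<open>Gram matrices and reflection representations\<close>

text \<open>\<open>K s t\<close> is the value of the pairing on the simple roots indexed by \<open>s\<close> and \<open>t\<close>. The infinite case is
stated through the product alone, without the square root $\gamma$ of that product.\<close>

locale coxeter_gram =
  fixes S :: "'s set" and m :: "'s \<Rightarrow> 's \<Rightarrow> enat" and K :: "'s \<Rightarrow> 's \<Rightarrow> real"
  assumes m_diag: "s \<in> S \<Longrightarrow> m s s = 1"
    and m_ge2: "s \<in> S \<Longrightarrow> t \<in> S \<Longrightarrow> s \<noteq> t \<Longrightarrow> 2 \<le> m s t"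
    and K_diag: "s \<in> S \<Longrightarrow> K s s = 1"
    and K_nonpos: "s \<in> S \<Longrightarrow> t \<in> S \<Longrightarrow> s \<noteq> t \<Longrightarrow> K s t \<le> 0"
    and K_finite: "s \<in> S \<Longrightarrow> t \<in> S \<Longrightarrow> m s t = enat k \<Longrightarrow> K s t * K t s = (cos (pi / real k))\<^sup>2"
    and K_infinite: "s \<in> S \<Longrightarrow> t \<in> S \<Longrightarrow> m s t = \<infinity> \<Longrightarrow> 1 \<le> K s t * K t s"
    and K_zero: "s \<in> S \<Longrightarrow> t \<in> S \<Longrightarrow> K s t = 0 \<longleftrightarrow> K t s = 0"
begin

text \<open>The scale is $\lambda = -2K_{sr}/q$ with $q = 2\sqrt{K_{rs}K_{sr}}$; if $q = 0$, both entries vanish and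
any scale serves.\<close>

lemma gauge:
  assumes "r \<in> S" "s \<in> S" "r \<noteq> s"
  obtains q l where "0 < l" "0 \<le> q" "- 2 * K s r = l * q" "- 2 * K r s = q / l"
    "q\<^sup>2 = 4 * (K r s * K s r)"
proof -
  define q where "q = 2 * sqrt (K r s * K s r)"
  have le: "K r s \<le> 0" "K s r \<le> 0"
    using K_nonpos assms by auto
  then have prod: "0 \<le> K r s * K s r"
    by (rule mult_nonpos_nonpos)
  then have q: "0 \<le> q" "q\<^sup>2 = 4 * (K r s * K s r)"
    by (auto simp: q_def power_mult_distrib)
  show thesis
  proof (cases "q = 0")
    case True
    then have "K r s = 0 \<and> K s r = 0"
      using K_zero[OF assms(1,2)] by (auto simp: q_def)
    then show thesis
      using that[of 1 0] by auto
  next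
    case False
    then have "K s r < 0" "0 < q"
      using le q by (auto simp: less_le)
    then show thesis
      using that[of "- 2 * K s r / q" q] q by (simp add: field_simps power2_eq_square)
  qed
qed

lemma cheb_admissible:
  assumes "r \<in> S" "s \<in> S" "r \<noteq> s" "0 \<le> q" "q\<^sup>2 = 4 * (K r s * K s r)"
    and "\<And>n. m r s = enat n \<Longrightarrow> j \<le> n"
  shows "admissible S m (cheb q j) (cheb q j) (cheb q j)"
proof (rule admissible_diag, cases "m r s")
  case (enat n)
  then have n: "2 \<le> n"
    using m_ge2[OF assms(1-3)] by (simp add: numeral_eq_enat)
  then have "0 \<le> 2 * cos (pi / real n)"
    by (intro mult_nonneg_nonneg cos_ge_zero) (auto simp: field_simps order_trans[of _ 0])
  moreover have "q\<^sup>2 = (2 * cos (pi / real n))\<^sup>2"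
    using assms(5) K_finite[OF assms(1,2) enat] by (simp add: power_mult_distrib)
  ultimately have "q = 2 * cos (pi / real n)"
    using assms(4) power2_eq_imp_eq by blast
  then show "cheb q j = 0 \<or> dihedral_value S m (cheb q j) \<or> 2 \<le> cheb q j"
    using cheb_finite_values[of n j r S s m, OF n assms(6)[OF enat] assms(1,2) enat] by simp
next
  case infinity
  then have "2\<^sup>2 \<le> q\<^sup>2"
    using assms(5) K_infinite[OF assms(1,2)] by simp
  then have "2 \<le> q"
    by (rule power2_le_imp_le) fact
  then show "cheb q j = 0 \<or> dihedral_value S m (cheb q j) \<or> 2 \<le> cheb q j"
    using cheb_infinite_values[of q j] by (auto simp: dihedral_value_def)
qed

text \<open>The parameters are tied to the matrix only through the products of opposite entries. This carries
the conditions over to the symmetric matrix of the standard realization.\<close>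

lemma same_products:
  assumes "\<And>s. s \<in> S \<Longrightarrow> K' s s = 1"
    and "\<And>s t. s \<in> S \<Longrightarrow> t \<in> S \<Longrightarrow> s \<noteq> t \<Longrightarrow> K' s t \<le> 0"
    and "\<And>s t. s \<in> S \<Longrightarrow> t \<in> S \<Longrightarrow> K' s t * K' t s = K s t * K t s"
    and "\<And>s t. s \<in> S \<Longrightarrow> t \<in> S \<Longrightarrow> K' s t = 0 \<longleftrightarrow> K' t s = 0"
  shows "coxeter_gram S m K'"
proof
  show "K' s t * K' t s = (cos (pi / real k))\<^sup>2" if "s \<in> S" "t \<in> S" "m s t = enat k" for s t k
    using K_finite[OF that] assms(3)[OF that(1,2)] by simp
  show "1 \<le> K' s t * K' t s" if "s \<in> S" "t \<in> S" "m s t = \<infinity>" for s t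
    using K_infinite[OF that] assms(3)[OF that(1,2)] by simp
qed (use assms m_diag m_ge2 in auto)

lemma transposed:
  assumes "\<And>s t. s \<in> S \<Longrightarrow> t \<in> S \<Longrightarrow> m s t = m t s"
  shows "coxeter_gram S m (\<lambda>s t. K t s)"
proof
  show "K t s * K s t = (cos (pi / real k))\<^sup>2" if "s \<in> S" "t \<in> S" "m s t = enat k" for s t k
    using K_finite[OF that] by (simp add: mult.commute)
  show "1 \<le> K t s * K s t" if "s \<in> S" "t \<in> S" "m s t = \<infinity>" for s t
    using K_infinite[OF that] by (simp add: mult.commute)
qed (use m_diag m_ge2 K_diag K_nonpos K_zero in auto)

end

definition reflection :: "('s \<Rightarrow> 'a::real_vector) \<Rightarrow> ('s \<Rightarrow> 'a \<Rightarrow> real) \<Rightarrow> 's \<Rightarrow> 'a \<Rightarrow> 'a" where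
  "reflection v f s x = x - (2 * f s x) *\<^sub>R v s"

text \<open>One half of a root datum; the other half enters only through the linear functionals \<open>f\<close> that its
simple roots define. Exchanging the halves transposes the matrix, so that each statement below
serves for both of them.\<close>

locale reflection_rep = coxeter_gram S m K
  for S :: "'s set" and m :: "'s \<Rightarrow> 's \<Rightarrow> enat" and K :: "'s \<Rightarrow> 's \<Rightarrow> real" +
  fixes v :: "'s \<Rightarrow> 'a::real_vector" and f :: "'s \<Rightarrow> 'a \<Rightarrow> real"
  assumes linear_f: "s \<in> S \<Longrightarrow> linear (f s)"
    and f_v: "s \<in> S \<Longrightarrow> t \<in> S \<Longrightarrow> f t (v s) = K s t"
begin

abbreviation R :: "'s \<Rightarrow> 'a \<Rightarrow> 'a" where
  "R \<equiv> reflection v f"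

lemma linear_R:
  assumes "s \<in> S"
  shows "linear (R s)"
proof (rule linearI)
  note lin = linear_f[OF assms]
  show "R s (x + y) = R s x + R s y" for x y
    by (simp add: reflection_def linear_add[OF lin] algebra_simps)
  show "R s (c *\<^sub>R x) = c *\<^sub>R R s x" for c x
    by (simp add: reflection_def linear_scale[OF lin] algebra_simps)
qed

lemma linear_word: "u \<in> lists S \<Longrightarrow> linear (foldr R u)"
  using linear_foldr[of S R u] linear_R by blast

lemma R_v:
  assumes "s \<in> S" "t \<in> S"
  shows "R t (v s) = v s - (2 * K s t) *\<^sub>R v t" "R s (v s) = - v s"
  using f_v[OF assms] f_v[OF assms(1) assms(1)] K_diag[OF assms(1)]
  by (simp_all add: reflection_def scaleR_2)

lemma R_R [simp]:
  assumes "s \<in> S"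
  shows "R s (R s x) = x"
proof -
  have "f s (R s x) = - f s x"
    unfolding reflection_def using linear_f[OF assms] f_v[OF assms assms] K_diag[OF assms]
    by (simp add: linear_diff linear_scale)
  then show ?thesis
    by (simp add: reflection_def[of v f s "R s x"]) (simp add: reflection_def)
qed

lemma foldr_rev_foldr: "u \<in> lists S \<Longrightarrow> foldr R (rev u) (foldr R u x) = x"
  by (induction u arbitrary: x) auto

lemma foldr_alt_v:
  assumes "r \<in> S" "s \<in> S" "l \<noteq> 0" "- 2 * K s r = l * q" "- 2 * K r s = q / l"
  shows "foldr R (alt r s k) (v s) =
    cheb q (Suc k) *\<^sub>R (if even k then v s else l *\<^sub>R v r)
    + cheb q k *\<^sub>R (if even k then l *\<^sub>R v r else v s)"
proof (rule foldr_alt)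
  have eq: "2 * K s r = - (l * q)" "2 * K r s = - (q / l)"
    using assms(4,5) by linarith+
  show "R r (v s) = v s + q *\<^sub>R (l *\<^sub>R v r)"
    using R_v(1)[OF assms(2,1)] unfolding eq by (simp add: mult.commute)
  show "R s (l *\<^sub>R v r) = l *\<^sub>R v r + q *\<^sub>R v s"
    using R_v(1)[OF assms(1,2)] linear_R[OF assms(2)] assms(3) unfolding eq
    by (simp add: linear_scale algebra_simps)
  show "R r (l *\<^sub>R v r) = - (l *\<^sub>R v r)"
    using R_v(2)[OF assms(1,1)] linear_R[OF assms(1)] by (simp add: linear_scale)
qed (use assms linear_R R_v in auto)

text \<open>On $\alpha_s$ and $\alpha_t$ the claim is the $2\pi$-periodicity of the sine. Every vector is a
combination of these two and of a vector on which both functionals vanish, since the determinant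
$1 - K_{st}K_{ts} = \sin^2(\pi/m_{st})$ of the rank-two Gram matrix is not zero.\<close>

lemma braid_relation:
  assumes st: "s \<in> S" "t \<in> S" and k: "m s t = enat k"
  shows "foldr R (concat (replicate k [s, t])) x = x"
proof (cases "s = t")
  case True
  then have "k = 1"
    using m_diag[OF st(1)] k by (simp add: one_enat_def)
  then show ?thesis
    using True st by simp
next
  case False
  then have k2: "2 \<le> k"
    using m_ge2[OF st] k by (simp add: numeral_eq_enat)
  define \<theta> where "\<theta> = pi / real k"
  have k\<theta>: "real k * \<theta> = pi" "0 < \<theta>" "\<theta> < pi"
    using k2 by (auto simp: \<theta>_def field_simps)
  then have s0: "0 < sin \<theta>"
    by (intro sin_gt_zero)
  have KK: "K s t * K t s = (cos \<theta>)\<^sup>2"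
    using K_finite[OF st k] by (simp add: \<theta>_def)
  obtain q l where ql: "0 < l" "0 \<le> q" "- 2 * K s t = l * q" "- 2 * K t s = q / l"
    "q\<^sup>2 = 4 * (K t s * K s t)"
    using gauge[OF st(2,1)] False by metis
  have c0: "0 \<le> cos \<theta>"
    using k2 k\<theta> mult_right_mono[of 2 "real k" \<theta>] by (intro cos_ge_zero) auto
  have "q\<^sup>2 = (2 * cos \<theta>)\<^sup>2"
    using ql(5) KK by (simp add: power_mult_distrib mult.commute)
  then have q: "q = 2 * cos \<theta>"
    by (rule power2_eq_imp_eq) (use ql(2) c0 in auto)
  have two_pi: "real (2 * k) * \<theta> = 2 * pi"
    using k\<theta>(1) by simp
  \<comment> \<open>The indices that occur are $2k - 1$, $2k$ and $2k + 1$, the sines of $2\pi - \theta$, $2\pi$ and $2\pi + \theta$.\<close>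
  have cheb: "cheb q (2 * k) = 0" "cheb q (Suc (2 * k)) = 1" "cheb q (2 * k - 1) = - 1"
  proof -
    show "cheb q (2 * k) = 0"
      using cheb_sin[of \<theta> "2 * k"] s0 unfolding two_pi q by simp
    have "real (Suc (2 * k)) * \<theta> = \<theta> + 2 * pi"
      using two_pi by (simp add: algebra_simps)
    then have "sin (real (Suc (2 * k)) * \<theta>) = sin \<theta>"
      by (simp only: sin_periodic)
    then show one: "cheb q (Suc (2 * k)) = 1"
      using cheb_sin[of \<theta> "Suc (2 * k)"] s0 unfolding q by simp
    show "cheb q (2 * k - 1) = - 1"
      using one \<open>cheb q (2 * k) = 0\<close> cheb.simps(3)[of q "2 * k - 1"] k2 by (simp del: cheb.simps)
  qed
  let ?T = "foldr R (alt t s (2 * k))"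
  have alts: "alt t s (2 * k) \<in> lists S"
    using alt_in_lists[OF st(2,1)] .
  note lin = linear_word[OF alts]
  have Ts: "?T (v s) = v s"
    using foldr_alt_v[OF st(2,1) _ ql(3,4), of "2 * k"] ql(1) cheb by simp
  have Tt: "?T (v t) = v t"
  proof -
    have "?T (v t) = foldr R (alt s t (2 * k - 1)) (R t (v t))"
      using k2 by (cases "2 * k") auto
    also have "\<dots> = - foldr R (alt s t (2 * k - 1)) (v t)"
      using R_v(2)[OF st(2,2)] linear_neg[OF linear_word[OF alt_in_lists[OF st]]] by simp
    also have "foldr R (alt s t (2 * k - 1)) (v t) = - v t"
    proof -
      have "- 2 * K t s = 1 / l * q" "- 2 * K s t = q / (1 / l)"
        using ql(3,4) by auto
      from foldr_alt_v[OF st _ this, of "2 * k - 1"] show ?thesis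
        using ql(1) cheb k2 by simp
    qed
    finally show ?thesis by simp
  qed
  define D where "D = 1 - K s t * K t s"
  have D: "D \<noteq> 0"
    using s0 KK by (simp add: D_def sin_squared_eq[symmetric])
  \<comment> \<open>Cramer's rule for the two conditions that both functionals vanish on \<open>y\<close>.\<close>
  define a where "a = (f s x - K t s * f t x) / D"
  define b where "b = (f t x - K s t * f s x) / D"
  define y where "y = x - a *\<^sub>R v s - b *\<^sub>R v t"
  have fs: "f s x = a + b * K t s" and ft: "f t x = a * K s t + b"
    using D by (simp_all add: a_def b_def field_simps) (simp_all add: D_def algebra_simps)
  have "f s y = 0" "f t y = 0"
    using fs ft f_v st K_diag by (simp_all add: y_def linear_diff linear_scale linear_f)
  then have fix_y: "R s y = y" "R t y = y"
    by (simp_all add: reflection_def)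
  have Ty: "?T y = y"
  proof -
    have "foldr R (alt p p' j) y = y" if "p \<in> {s, t}" "p' \<in> {s, t}" for p p' j
      using that by (induction p p' j rule: alt.induct) (use fix_y in auto)
    then show ?thesis by auto
  qed
  have "x = y + a *\<^sub>R v s + b *\<^sub>R v t"
    by (simp add: y_def)
  then have "?T x = x"
    using Ty Ts Tt lin by (simp add: linear_add linear_scale)
  then show ?thesis
    by (simp add: concat_replicate_eq_alt)
qed

lemma foldr_cong_word:
  assumes "(u, w) \<in> coxeter_cong S m"
  shows "foldr R u x = foldr R w x"
  using assms by (rule foldr_coxeter_cong) (auto intro: braid_relation)

end

section \<open>Indexed bases\<close>

lemma basis_family_span: "basis_family S b \<Longrightarrow> x \<in> span (b ` S)"
  by (simp add: basis_family_def)

lemma linear_basis_coeff: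
  assumes "basis_family S b"
  shows "linear (\<lambda>x. basis_coeff S b x s)"
proof -
  have "independent (b ` S)"
    using assms by (simp add: basis_family_def)
  then show ?thesis
    using basis_family_span[OF assms] unfolding basis_coeff_def
    by (intro linearI) (simp_all add: representation_add representation_scale)
qed

lemma basis_coeff_linear:
  assumes "basis_family S b"
  shows "basis_coeff S b (x + y) s = basis_coeff S b x s + basis_coeff S b y s"
    "basis_coeff S b (a *\<^sub>R x) s = a * basis_coeff S b x s"
    "basis_coeff S b (- x) s = - basis_coeff S b x s"
  using linear_add[OF linear_basis_coeff[OF assms]] linear_scale[OF linear_basis_coeff[OF assms]]
    linear_neg[OF linear_basis_coeff[OF assms]] by auto

lemma basis_coeff_basis:
  assumes "basis_family S b" "s \<in> S" "t \<in> S"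
  shows "basis_coeff S b (b s) t = of_bool (s = t)"
  using assms representation_basis[of "b ` S" "b s"]
  by (auto simp: basis_coeff_def basis_family_def inj_on_eq_iff)

lemma basis_expansion:
  assumes b: "basis_family S b"
  obtains F where "finite F" "F \<subseteq> S" "x = (\<Sum>s\<in>F. basis_coeff S b x s *\<^sub>R b s)"
    "\<And>s. s \<in> S - F \<Longrightarrow> basis_coeff S b x s = 0"
proof -
  let ?N = "{v. representation (b ` S) x v \<noteq> 0}"
  define F where "F = {s \<in> S. basis_coeff S b x s \<noteq> 0}"
  have inj: "inj_on b F" "independent (b ` S)"
    using b by (auto simp: F_def basis_family_def intro: inj_on_subset)
  have N: "?N = b ` F"
    using representation_ne_zero[of "b ` S" x] by (auto simp: F_def basis_coeff_def)
  then have "finite (b ` F)"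
    using finite_representation[of "b ` S" x] by simp
  then have fin: "finite F"
    using inj(1) by (rule finite_imageD)
  have expand: "x = (\<Sum>s\<in>F. basis_coeff S b x s *\<^sub>R b s)"
    using sum_nonzero_representation_eq[OF inj(2) basis_family_span[OF b], of x]
    by (simp add: N sum.reindex[OF inj(1)] basis_coeff_def)
  show thesis
    by (rule that[OF fin _ expand]) (auto simp: F_def)
qed

lemma basis_coeff_eqI:
  assumes b: "basis_family S b" and eq: "\<And>s. s \<in> S \<Longrightarrow> basis_coeff S b x s = basis_coeff S b y s"
  shows "x = y"
proof -
  obtain F where F: "F \<subseteq> S" "x - y = (\<Sum>s\<in>F. basis_coeff S b (x - y) s *\<^sub>R b s)"
    using basis_expansion[OF b, of "x - y"] by metis
  have "basis_coeff S b (x - y) s = 0" if "s \<in> F" for s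
    using eq[of s] that F(1) linear_diff[OF linear_basis_coeff[OF b]] by auto
  then have "(\<Sum>s\<in>F. basis_coeff S b (x - y) s *\<^sub>R b s) = 0"
    by (intro sum.neutral) simp
  then have "x - y = 0"
    using F(2) by metis
  then show ?thesis by simp
qed

lemma basis_linear_extension:
  assumes b: "basis_family S b"
  shows "\<exists>!f. linear f \<and> (\<forall>s\<in>S. f (b s) = g s)"
proof -
  have inj: "inj_on b S" "independent (b ` S)"
    using b by (auto simp: basis_family_def)
  obtain f where f: "linear f" "\<forall>x\<in>b ` S. f x = g (the_inv_into S b x)"
    using linear_independent_extend[OF inj(2), of "\<lambda>x. g (the_inv_into S b x)"] by blast
  have "\<forall>s\<in>S. f (b s) = g s"
    using f(2) inj(1) by (simp add: the_inv_into_f_f)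
  moreover have "h = h'"
    if "linear h" "\<forall>s\<in>S. h (b s) = g s" "linear h'" "\<forall>s\<in>S. h' (b s) = g s" for h h'
    by (rule ext, rule linear_eq_on[OF that(1,3) basis_family_span[OF b]]) (use that(2,4) in auto)
  ultimately show ?thesis
    using f(1) by blast
qed

section \<open>Comparing roots in a quotient of the free realization\<close>

text \<open>Passes from coefficients attached to vectors to coefficients attached to indices.\<close>

lemma PLC_zero_coeffs:
  fixes v :: "'s \<Rightarrow> 'a::real_vector"
  assumes v: "0 \<notin> PLC (v ` S)" "inj_on v S" and F: "finite F" "F \<subseteq> S"
    and l: "\<And>s. s \<in> F \<Longrightarrow> 0 \<le> l s" and sum: "(\<Sum>s\<in>F. l s *\<^sub>R v s) = 0" and s: "s \<in> F"
  shows "l s = 0"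
proof (rule ccontr)
  assume "l s \<noteq> 0"
  then have ls: "0 < l s" using l[OF s] by simp
  have inj: "inj_on v F"
    using v(2) F(2) by (rule inj_on_subset)
  let ?l = "\<lambda>x. l (the_inv_into F v x)"
  have inv: "?l (v i) = l i" if "i \<in> F" for i
    using that inj by (simp add: the_inv_into_f_f)
  have "(\<Sum>x\<in>v ` F. ?l x *\<^sub>R x) = (\<Sum>s\<in>F. l s *\<^sub>R v s)"
    by (simp add: sum.reindex[OF inj] inv)
  then have "0 \<in> PLC (v ` S)"
    unfolding PLC_def mem_Collect_eq using F l sum s ls
    by (intro exI[of _ "v ` F"] exI[of _ ?l]) (auto simp: inv intro!: bexI[of _ s])
  with v(1) show False ..
qed

context reflection_rep
begin

text \<open>Equal simple roots would have pairing $1$, whereas distinct indices have pairing at most $0$.\<close>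

lemma inj_v: "inj_on v S"
proof (rule inj_onI, rule ccontr)
  fix s t assume st: "s \<in> S" "t \<in> S" "v s = v t" "s \<noteq> t"
  then have "K s t = 1"
    using f_v[of s t] f_v[of t t] K_diag by simp
  then show False
    using K_nonpos[of s t] st by simp
qed

lemma foldr_linear_image:
  assumes p: "linear p" "\<And>s. s \<in> S \<Longrightarrow> p (v s) = v' s"
    and f': "\<And>s x. s \<in> S \<Longrightarrow> f' s (p x) = f s x" and u: "u \<in> lists S"
  shows "p (foldr R u x) = foldr (reflection v' f') u (p x)"
proof -
  have "p (R s y) = reflection v' f' s (p y)" if "s \<in> S" for s y
    using that by (simp add: reflection_def p f' linear_diff linear_scale)
  then show ?thesis
    using u by (induction u) auto
qed

text \<open>Subtracting $v_t$ gives a relation among the simple roots. If its coefficients have one sign, they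
vanish because zero is not a positive combination. Otherwise only the coefficient at $t$ is
negative, and then applying $f_t$ to the relation yields a negative number.\<close>

lemma simple_root_relation_trivial:
  assumes plc: "0 \<notin> PLC (v ` S)" and F: "finite F" "F \<subseteq> S" and t: "t \<in> S"
    and sum: "v t = (\<Sum>s\<in>F. c s *\<^sub>R v s)" and sgn: "(\<forall>s\<in>F. 0 \<le> c s) \<or> (\<forall>s\<in>F. c s \<le> 0)"
  shows "t \<in> F \<and> c t = 1 \<and> (\<forall>s\<in>F - {t}. c s = 0)"
proof -
  define d where "d = (\<lambda>s. if s \<in> F then c s else 0)"
  define e where "e = (\<lambda>s. d s - of_bool (s = t))"
  let ?F = "insert t F"
  have "(\<Sum>s\<in>?F. d s *\<^sub>R v s) = v t"
    unfolding sum by (rule sum.mono_neutral_cong_right) (use F in \<open>auto simp: d_def\<close>)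
  moreover have "(\<Sum>s\<in>?F. of_bool (s = t) *\<^sub>R v s) = v t"
  proof -
    have "(\<Sum>s\<in>?F. of_bool (s = t) *\<^sub>R v s) = (\<Sum>s\<in>{t}. v s)"
      by (rule sum.mono_neutral_cong_right) (use F in auto)
    then show ?thesis by simp
  qed
  ultimately have zero: "(\<Sum>s\<in>?F. e s *\<^sub>R v s) = 0"
    by (simp add: e_def scaleR_diff_left sum_subtractf del: sum.insert_if)
  have F': "finite ?F" "?F \<subseteq> S"
    using F t by auto
  have e0: "e s = 0" if "s \<in> ?F" for s
  proof (cases "\<forall>s\<in>?F. 0 \<le> d s")
    case pos: True
    show ?thesis
    proof (cases "1 \<le> d t")
      case True
      then have "\<And>s. s \<in> ?F \<Longrightarrow> 0 \<le> e s"
        using pos by (auto simp: e_def)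
      from PLC_zero_coeffs[OF plc inj_v F' this zero that] show ?thesis .
    next
      case False
          have "f t (\<Sum>s\<in>?F. e s *\<^sub>R v s) = (\<Sum>s\<in>?F. e s * K s t)"
        using F' t by (auto simp: linear_sum[OF linear_f[OF t]] linear_scale[OF linear_f[OF t]] f_v
            simp del: sum.insert_if intro!: sum.cong)
      also have "\<dots> = e t * K t t + (\<Sum>s\<in>?F - {t}. e s * K s t)"
        using F' by (intro sum.remove) auto
      also have "\<dots> < 0"
      proof -
        have "(\<Sum>s\<in>?F - {t}. e s * K s t) \<le> 0"
          using pos F' t K_nonpos by (intro sum_nonpos mult_nonneg_nonpos) (auto simp: e_def)
        then show ?thesis
          using False K_diag[OF t] by (simp add: e_def)
      qed
      finally show ?thesis
        using zero linear_0[OF linear_f[OF t]] by simp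
    qed
  next
    case False
    then have "\<not> (\<forall>s\<in>F. 0 \<le> c s)"
      by (auto simp: d_def split: if_splits)
    then have "\<forall>s\<in>F. c s \<le> 0"
      using sgn by blast
    then have neg: "\<And>s. s \<in> ?F \<Longrightarrow> 0 \<le> - e s"
      by (auto simp: e_def d_def)
    have "(\<Sum>s\<in>?F. (- e s) *\<^sub>R v s) = 0"
      using zero by (simp add: sum_negf del: sum.insert_if)
    from PLC_zero_coeffs[OF plc inj_v F' neg this that] show ?thesis
      by simp
  qed
  have "d t = 1" "\<And>s. s \<in> F \<Longrightarrow> s \<noteq> t \<Longrightarrow> c s = 0"
    using e0[of t] e0 by (force simp: e_def d_def)+
  then show ?thesis
    by (auto simp: d_def split: if_splits)
qed

lemma PLC_not_nonpos_combination:
  assumes plc: "0 \<notin> PLC (v ` S)" and x: "x \<in> PLC (v ` S)" and F: "finite F" "F \<subseteq> S"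
    and sum: "x = (\<Sum>s\<in>F. c s *\<^sub>R v s)" and neg: "\<And>s. s \<in> F \<Longrightarrow> c s \<le> 0"
  shows False
proof -
  obtain A l where A: "finite A" "A \<subseteq> v ` S" and l: "\<forall>a\<in>A. 0 \<le> l a" "\<exists>a\<in>A. 0 < l a"
    and xA: "x = (\<Sum>a\<in>A. l a *\<^sub>R a)"
    using x unfolding PLC_def by blast
  obtain B where B: "finite B" "B \<subseteq> S" "A = v ` B"
    using finite_subset_image[OF A] by blast
  have inj: "inj_on v B"
    using inj_v B(2) by (rule inj_on_subset)
  have xB: "x = (\<Sum>s\<in>B. l (v s) *\<^sub>R v s)"
    by (simp add: xA B(3) sum.reindex[OF inj])
  define d where "d = (\<lambda>s. if s \<in> B then l (v s) else 0)"
  define e where "e = (\<lambda>s. if s \<in> F then c s else 0)"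
  have fin: "finite (B \<union> F)" "B \<union> F \<subseteq> S"
    using B F by auto
  have "(\<Sum>s\<in>B \<union> F. d s *\<^sub>R v s) = x"
    unfolding xB by (rule sum.mono_neutral_cong_right) (use fin in \<open>auto simp: d_def\<close>)
  moreover have "(\<Sum>s\<in>B \<union> F. e s *\<^sub>R v s) = x"
    unfolding sum by (rule sum.mono_neutral_cong_right) (use fin in \<open>auto simp: e_def\<close>)
  ultimately have zero: "(\<Sum>s\<in>B \<union> F. (d s - e s) *\<^sub>R v s) = 0"
    by (simp add: scaleR_diff_left sum_subtractf)
  have nonneg: "0 \<le> d s" "e s \<le> 0" for s
    using l(1) neg B(3) by (auto simp: d_def e_def)
  have diff: "d s - e s = 0" if "s \<in> B \<union> F" for s
    by (rule PLC_zero_coeffs[OF plc inj_v fin _ zero that])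
      (use nonneg in \<open>simp add: order_trans[of _ 0]\<close>)
  obtain s where s: "s \<in> B" "0 < l (v s)"
    using l(2) B(3) by blast
  then show False
    using diff[of s] nonneg(2)[of s] by (simp add: d_def)
qed

end

text \<open>A linear map that matches simple roots of two families with the same matrix also matches the
functionals, since these agree on a basis.\<close>

lemma projection_equivariant:
  assumes free: "reflection_rep S m K v' f'" and rep: "reflection_rep S m K v f"
    and b: "basis_family S v'" and p: "linear p" "\<And>s. s \<in> S \<Longrightarrow> p (v' s) = v s"
    and u: "u \<in> lists S"
  shows "p (foldr (reflection v' f') u x) = foldr (reflection v f) u (p x)"
proof -
  interpret free: reflection_rep S m K v' f' by fact
  interpret rep: reflection_rep S m K v f by fact
  have fp: "f i (p x) = f' i x" if i: "i \<in> S" for i x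
  proof -
    have "linear (\<lambda>x. f i (p x))"
      using linear_compose[OF p(1) rep.linear_f[OF i]] by (simp add: o_def)
    then show ?thesis
      by (rule linear_eq_on[OF _ free.linear_f[OF i] basis_family_span[OF b]])
        (use i p(2) free.f_v rep.f_v in auto)
  qed
  show ?thesis
    using free.foldr_linear_image[OF p fp u] .
qed

text \<open>Applying the inverse of \<open>w\<close> reduces the claim to a root that projects to a simple root.\<close>

lemma projection_inj_on_roots:
  assumes free: "reflection_rep S m K v' f'" and rep: "reflection_rep S m K v f"
    and b: "basis_family S v'" and plc: "0 \<notin> PLC (v ` S)"
    and p: "linear p" "\<And>s. s \<in> S \<Longrightarrow> p (v' s) = v s"
    and sgn: "\<And>u s. u \<in> lists S \<Longrightarrow> s \<in> S \<Longrightarrow>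
      (\<forall>j\<in>S. 0 \<le> basis_coeff S v' (foldr (reflection v' f') u (v' s)) j)
      \<or> (\<forall>j\<in>S. basis_coeff S v' (foldr (reflection v' f') u (v' s)) j \<le> 0)"
    and u: "u \<in> lists S" "s \<in> S" and w: "w \<in> lists S" "t \<in> S"
    and eq: "p (foldr (reflection v' f') u (v' s)) = p (foldr (reflection v' f') w (v' t))"
  shows "foldr (reflection v' f') u (v' s) = foldr (reflection v' f') w (v' t)"
proof -
  interpret free: reflection_rep S m K v' f' by fact
  interpret rep: reflection_rep S m K v f by fact
  have equiv: "p (foldr free.R z x) = foldr rep.R z (p x)" if "z \<in> lists S" for z x
    using projection_equivariant[OF free rep b p(1) _ that] p(2) by blast
  let ?y = "foldr free.R (rev w @ u) (v' s)"
  have "p ?y = foldr rep.R (rev w) (p (foldr free.R u (v' s)))"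
    using equiv[OF rev_in_lists[OF w(1)]] by simp
  also have "\<dots> = v t"
    using eq equiv w p(2) rep.foldr_rev_foldr by simp
  finally have py: "p ?y = v t" .
  have wu: "rev w @ u \<in> lists S"
    using u(1) rev_in_lists[OF w(1)] by simp
  obtain F where F: "finite F" "F \<subseteq> S" "?y = (\<Sum>j\<in>F. basis_coeff S v' ?y j *\<^sub>R v' j)"
    "\<And>j. j \<in> S - F \<Longrightarrow> basis_coeff S v' ?y j = 0"
    using basis_expansion[OF b, of ?y] by blast
  have "v t = (\<Sum>j\<in>F. basis_coeff S v' ?y j *\<^sub>R v j)"
    using arg_cong[OF F(3), of p] F(2) p unfolding py
    by (auto simp: linear_sum[OF p(1)] linear_scale[OF p(1)] intro!: sum.cong)
  from rep.simple_root_relation_trivial[OF plc F(1,2) w(2) this] sgn[OF wu u(2)] F(2)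
  have *: "t \<in> F \<and> basis_coeff S v' ?y t = 1 \<and> (\<forall>j\<in>F - {t}. basis_coeff S v' ?y j = 0)"
    by blast
  have "?y = v' t"
    by (rule basis_coeff_eqI[OF b]) (use * F(4) basis_coeff_basis[OF b w(2)] in auto)
  then have "foldr free.R w ?y = foldr free.R w (v' t)" by simp
  then show ?thesis
    using free.foldr_rev_foldr[OF rev_in_lists[OF w(1)]] by simp
qed

section \<open>Root data\<close>

abbreviation pairing_matrix :: "('s, 'a, 'b) coxeter_tuple \<Rightarrow> 's \<Rightarrow> 's \<Rightarrow> real" where
  "pairing_matrix D s t \<equiv> pairing D (root1 D s) (root2 D t)"

text \<open>The given datum, the free datum and the standard realization are all instances. For the last two,
linear independence of the simple roots takes the place of the condition on positive combinations.\<close>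

locale root_datum =
  fixes D :: "('s, 'a::real_vector, 'b::real_vector) coxeter_tuple"
  assumes bilinear_pairing: "bilinear (pairing D)"
    and param_sym: "s \<in> index D \<Longrightarrow> t \<in> index D \<Longrightarrow> param D s t = param D t s"
    and gram: "coxeter_gram (index D) (param D) (pairing_matrix D)"

lemma refl1_eq_reflection:
  "refl1 D = reflection (root1 D) (\<lambda>s x. pairing D x (root2 D s))"
  by (auto simp: refl1_def reflection_def fun_eq_iff)

lemma refl2_eq_reflection:
  "refl2 D = reflection (root2 D) (\<lambda>s y. pairing D (root1 D s) y)"
  by (auto simp: refl2_def reflection_def fun_eq_iff)

lemma root_datum_if_coxeter_datum:
  assumes "coxeter_datum C"
  shows "root_datum C"
proof (rule root_datum.intro)
  note C = assms[unfolded coxeter_datum_def]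
  note C1 = C[THEN conjunct1] and C' = C[THEN conjunct2]
  note C2 = C'[THEN conjunct1] and C'' = C'[THEN conjunct2]
  note C3 = C''[THEN conjunct1] and C4 = C''[THEN conjunct2, THEN conjunct1]
    and D = C''[THEN conjunct2, THEN conjunct2]
  note C5 = D[THEN conjunct1] and C6 = D[THEN conjunct2, THEN conjunct1]
    and D' = D[THEN conjunct2, THEN conjunct2]
  note C7 = D'[THEN conjunct1] and C8 = D'[THEN conjunct2, THEN conjunct1]
  show "bilinear (pairing C)" by (rule C4)
  show "param C s t = param C t s" if "s \<in> index C" "t \<in> index C" for s t
    using C2 that by blast
  have fin: "pairing_matrix C s t * pairing_matrix C t s = (cos (pi / real k))\<^sup>2"
    if "s \<in> index C" "t \<in> index C" "param C s t = enat k" for s t k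
    using bspec[OF bspec[OF C7 that(1)] that(2)] that(3) by simp
  have inf: "1 \<le> pairing_matrix C s t * pairing_matrix C t s"
    if "s \<in> index C" "t \<in> index C" "param C s t = \<infinity>" for s t
    using bspec[OF bspec[OF C7 that(1)] that(2)] that(3) by (auto intro: one_le_power)
  show "coxeter_gram (index C) (param C) (pairing_matrix C)"
  proof (rule coxeter_gram.intro)
    fix s assume "s \<in> index C"
    then show "param C s s = 1" "pairing_matrix C s s = 1"
      using C1 C5 by blast+
  next
    fix s t assume st: "s \<in> index C" "t \<in> index C" "s \<noteq> t"
    then show "2 \<le> param C s t" "pairing_matrix C s t \<le> 0"
      using C3 C6 by blast+
  next
    fix s t assume "s \<in> index C" "t \<in> index C"
    then show "pairing_matrix C s t = 0 \<longleftrightarrow> pairing_matrix C t s = 0"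
      using C8 by blast
  qed (use fin inf in blast)+
qed

context root_datum
begin

sublocale side1: reflection_rep "index D" "param D" "pairing_matrix D" "root1 D"
  "\<lambda>s x. pairing D x (root2 D s)"
  using gram bilinear_pairing
  by (auto simp: reflection_rep_def reflection_rep_axioms_def bilinear_def)

sublocale side2: reflection_rep "index D" "param D" "\<lambda>s t. pairing_matrix D t s" "root2 D"
  "\<lambda>s y. pairing D (root1 D s) y"
  using coxeter_gram.transposed[OF gram param_sym] bilinear_pairing
  by (auto simp: reflection_rep_def reflection_rep_axioms_def bilinear_def)

lemma pairing_invariant:
  assumes "u \<in> lists (index D)"
  shows "pairing D (foldr (refl1 D) u x) (foldr (refl2 D) u y) = pairing D x y"
  using assms
proof (induction u)
  case (Cons s u)
  note bl = bilinear_lsub[OF bilinear_pairing] bilinear_rsub[OF bilinear_pairing]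
    bilinear_lmul[OF bilinear_pairing] bilinear_rmul[OF bilinear_pairing]
  have s: "s \<in> index D"
    using Cons by simp
  have "pairing D (refl1 D s x') (refl2 D s y') = pairing D x' y'" for x' y'
    using side1.K_diag[OF s] by (simp add: refl1_def refl2_def bl algebra_simps)
  then show ?case
    using Cons by simp
qed simp

lemma refl_same:
  assumes "s \<in> index D"
  shows "refl1 D s (root1 D s) = - root1 D s" "refl2 D s (root2 D s) = - root2 D s"
  using side1.R_v(2)[OF assms assms] side2.R_v(2)[OF assms assms]
  by (simp_all add: refl1_eq_reflection refl2_eq_reflection)

lemma foldr_refl_cong:
  assumes "(u, w) \<in> coxeter_cong (index D) (param D)"
  shows "foldr (refl1 D) u x = foldr (refl1 D) w x" "foldr (refl2 D) u y = foldr (refl2 D) w y"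
  using side1.foldr_cong_word[OF assms] side2.foldr_cong_word[OF assms]
  by (simp_all add: refl1_eq_reflection refl2_eq_reflection)

lemma linear_foldr_refl:
  assumes "u \<in> lists (index D)"
  shows "linear (foldr (refl1 D) u)" "linear (foldr (refl2 D) u)"
  using side1.linear_word[OF assms] side2.linear_word[OF assms]
  by (simp_all add: refl1_eq_reflection refl2_eq_reflection)

lemma foldr_refl_rev:
  assumes "u \<in> lists (index D)"
  shows "foldr (refl1 D) (rev u) (foldr (refl1 D) u x) = x"
    "foldr (refl2 D) (rev u) (foldr (refl2 D) u y) = y"
  using side1.foldr_rev_foldr[OF assms] side2.foldr_rev_foldr[OF assms]
  by (simp_all add: refl1_eq_reflection refl2_eq_reflection)

lemma act_class:
  assumes "u \<in> lists (index D)"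
  shows "act1 D (coxeter_cong (index D) (param D) `` {u}) x = foldr (refl1 D) u x"
    "act2 D (coxeter_cong (index D) (param D) `` {u}) y = foldr (refl2 D) u y"
proof -
  let ?w = "coxeter_cong (index D) (param D) `` {u}"
  have u: "u \<in> ?w"
    using coxeter_cong.cong_refl[OF assms] by simp
  have "foldr (refl1 D) z x = foldr (refl1 D) u x" "foldr (refl2 D) z y = foldr (refl2 D) u y"
    if "z \<in> ?w" for z
    using that foldr_refl_cong[of u z] by auto
  with u show "act1 D ?w x = foldr (refl1 D) u x" "act2 D ?w y = foldr (refl2 D) u y"
    unfolding act1_def act2_def by (blast intro: the_elem_image_unique)+
qed

end

lemma carrier_coxeter_group:
  "carrier (coxeter_group S m) = {coxeter_cong S m `` {u} | u. u \<in> lists S}"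
  by (auto simp: coxeter_group_def quotient_def)

context root_datum
begin

lemma Phi1_eq: "Phi1 D = {foldr (refl1 D) u (root1 D s) | u s. u \<in> lists (index D) \<and> s \<in> index D}"
proof (intro equalityI subsetI)
  fix x assume "x \<in> Phi1 D"
  then obtain u s where "u \<in> lists (index D)" "s \<in> index D"
    "x = act1 D (coxeter_cong (index D) (param D) `` {u}) (root1 D s)"
    unfolding Phi1_def carrier_coxeter_group by blast
  then show "x \<in> {foldr (refl1 D) u (root1 D s) | u s. u \<in> lists (index D) \<and> s \<in> index D}"
    using act_class(1) by blast
next
  fix x assume "x \<in> {foldr (refl1 D) u (root1 D s) | u s. u \<in> lists (index D) \<and> s \<in> index D}"
  then obtain u s where "u \<in> lists (index D)" "s \<in> index D" "x = foldr (refl1 D) u (root1 D s)"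
    by blast
  then have "x = act1 D (coxeter_cong (index D) (param D) `` {u}) (root1 D s)"
    "coxeter_cong (index D) (param D) `` {u} \<in> carrier (W D)"
    using act_class(1)[of u] unfolding carrier_coxeter_group by auto
  then show "x \<in> Phi1 D"
    unfolding Phi1_def using \<open>s \<in> index D\<close> by blast
qed

lemma Phi2_eq: "Phi2 D = {foldr (refl2 D) u (root2 D s) | u s. u \<in> lists (index D) \<and> s \<in> index D}"
proof (intro equalityI subsetI)
  fix x assume "x \<in> Phi2 D"
  then obtain u s where "u \<in> lists (index D)" "s \<in> index D"
    "x = act2 D (coxeter_cong (index D) (param D) `` {u}) (root2 D s)"
    unfolding Phi2_def carrier_coxeter_group by blast
  then show "x \<in> {foldr (refl2 D) u (root2 D s) | u s. u \<in> lists (index D) \<and> s \<in> index D}"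
    using act_class(2) by blast
next
  fix x assume "x \<in> {foldr (refl2 D) u (root2 D s) | u s. u \<in> lists (index D) \<and> s \<in> index D}"
  then obtain u s where "u \<in> lists (index D)" "s \<in> index D" "x = foldr (refl2 D) u (root2 D s)"
    by blast
  then have "x = act2 D (coxeter_cong (index D) (param D) `` {u}) (root2 D s)"
    "coxeter_cong (index D) (param D) `` {u} \<in> carrier (W D)"
    using act_class(2)[of u] unfolding carrier_coxeter_group by auto
  then show "x \<in> Phi2 D"
    unfolding Phi2_def using \<open>s \<in> index D\<close> by blast
qed

end

section \<open>Signs and sizes of coefficients\<close>

locale symmetrized_pair =
  D: root_datum D + E: root_datum E
  for D :: "('s, 'a::real_vector, 'b::real_vector) coxeter_tuple"
    and E :: "('s, 'v::real_vector, 'v) coxeter_tuple" +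
  assumes index_eq: "index E = index D" and param_eq: "param E = param D"
    and root2_E: "root2 E = root1 E"
    and basis1: "basis_family (index D) (root1 D)"
    and basis2: "basis_family (index D) (root2 D)"
    and basisE: "basis_family (index D) (root1 E)"
    and pairing_E_sym: "pairing E x y = pairing E y x"
    and pairing_E_sq: "s \<in> index D \<Longrightarrow> t \<in> index D \<Longrightarrow>
      (pairing_matrix E s t)\<^sup>2 = pairing_matrix D s t * pairing_matrix D t s"
begin

abbreviation "root1_coeff t u s \<equiv>
  basis_coeff (index D) (root1 D) (foldr (refl1 D) u (root1 D s)) t"
abbreviation "root2_coeff t u s \<equiv>
  basis_coeff (index D) (root2 D) (foldr (refl2 D) u (root2 D s)) t"
abbreviation "rootE_coeff t u s \<equiv>
  basis_coeff (index D) (root1 E) (foldr (refl1 E) u (root1 E s)) t"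

lemma linear_combination_coeff:
  assumes "basis_family S b" "linear T" "\<And>x. g x = basis_coeff S b (T x) t"
  shows "g (p *\<^sub>R x + q *\<^sub>R y) = p * g x + q * g y"
  using assms(2) unfolding assms(3)
  by (simp add: linear_add linear_scale basis_coeff_linear[OF assms(1)])

text \<open>All three realizations are governed by the same number $q$, and their rank-two coefficients differ
by the scales $\lambda$, $\lambda^{-1}$ and $1$, which form an admissible triple. The claim is then an
instance of closure under sums and products.\<close>

lemma dihedral_step:
  assumes r: "r \<in> index D" and s: "s \<in> index D" and rs: "r \<noteq> s"
    and v: "v \<in> lists (index D)"
    and k: "\<And>n. param D r s = enat n \<Longrightarrow> k < n"
    and adm: "\<And>x. x \<in> {r, s} \<Longrightarrow>
      admissible (index D) (param D) (root1_coeff t v x) (root2_coeff t v x) (rootE_coeff t v x)"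
  shows "admissible (index D) (param D) (root1_coeff t (v @ alt r s k) s)
    (root2_coeff t (v @ alt r s k) s) (rootE_coeff t (v @ alt r s k) s)"
proof -
  obtain q l where l: "0 < l" "0 \<le> q" and k1: "- 2 * pairing_matrix D s r = l * q"
    and k2: "- 2 * pairing_matrix D r s = q / l"
    and qq: "q\<^sup>2 = 4 * (pairing_matrix D r s * pairing_matrix D s r)"
    using D.side1.gauge[OF r s rs] by metis
  have "(- 2 * pairing_matrix E s r)\<^sup>2 = q\<^sup>2"
    using pairing_E_sq[OF s r] qq by (simp add: power_mult_distrib mult.commute)
  moreover have "0 \<le> - 2 * pairing_matrix E s r"
    using E.side1.K_nonpos[of s r] r s rs index_eq by simp
  ultimately have kE: "- 2 * pairing_matrix E s r = q" "- 2 * pairing_matrix E r s = q"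
    using l(2) power2_eq_imp_eq pairing_E_sym root2_E by metis+
  define a where "a = (if even k then cheb q (Suc k) else cheb q k)"
  define b where "b = (if even k then cheb q k else cheb q (Suc k))"
  have adm_cheb: "admissible (index D) (param D) (cheb q j) (cheb q j) (cheb q j)" if "j \<le> Suc k" for j
    using D.side1.cheb_admissible[OF r s rs l(2) qq, of j] k that by fastforce
  have w1: "foldr (refl1 D) (alt r s k) (root1 D s) = a *\<^sub>R root1 D s + (l * b) *\<^sub>R root1 D r"
    using D.side1.foldr_alt_v[OF r s _ k1 k2, of k] l(1)
    by (simp add: refl1_eq_reflection a_def b_def mult.commute)
  have w2: "foldr (refl2 D) (alt r s k) (root2 D s) = a *\<^sub>R root2 D s + (1 / l * b) *\<^sub>R root2 D r"
    using D.side2.foldr_alt_v[OF r s, of "1 / l" q k] l(1) k1 k2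
    by (simp add: refl2_eq_reflection a_def b_def mult.commute)
  have wE: "foldr (refl1 E) (alt r s k) (root1 E s) = a *\<^sub>R root1 E s + (1 * b) *\<^sub>R root1 E r"
    using E.side1.foldr_alt_v[of r s 1 q k] r s kE index_eq
    by (simp add: refl1_eq_reflection a_def b_def)
  have vE: "v \<in> lists (index E)"
    using v index_eq by simp
  have c1: "root1_coeff t (v @ alt r s k) s = a * root1_coeff t v s + (l * b) * root1_coeff t v r"
    unfolding foldr_append comp_def w1
    by (rule linear_combination_coeff[OF basis1 D.linear_foldr_refl(1)[OF v] refl])
  have c2: "root2_coeff t (v @ alt r s k) s = a * root2_coeff t v s + (1 / l * b) * root2_coeff t v r"
    unfolding foldr_append comp_def w2
    by (rule linear_combination_coeff[OF basis2 D.linear_foldr_refl(2)[OF v] refl])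
  have cE: "rootE_coeff t (v @ alt r s k) s = a * rootE_coeff t v s + (1 * b) * rootE_coeff t v r"
    unfolding foldr_append comp_def wE
    by (rule linear_combination_coeff[OF basisE E.linear_foldr_refl(1)[OF vE] refl])
  have "admissible (index D) (param D) a a a" "admissible (index D) (param D) b b b"
    using adm_cheb[of k] adm_cheb[of "Suc k"] by (auto simp: a_def b_def)
  then show ?thesis
    unfolding c1 c2 cE
    by (intro admissible_add admissible_mult admissible_scale l(1)) (use adm in auto)
qed

text \<open>The induction on length of the positivity theorem of Tits, carried out for the three realizations
in parallel. A descent \<open>r\<close> of \<open>u\<close> is found as the last letter of a reduced word.\<close>

lemma admissible_if_ascent:
  assumes "u \<in> lists (index D)" "s \<in> index D" "t \<in> index D"
    and "wlen (index D) (param D) u < wlen (index D) (param D) (u @ [s])"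
  shows "admissible (index D) (param D) (root1_coeff t u s) (root2_coeff t u s) (rootE_coeff t u s)"
  using assms
proof (induction "wlen (index D) (param D) u" arbitrary: u s rule: less_induct)
  case less
  let ?l = "wlen (index D) (param D)"
  note u = less.prems(1) and s = less.prems(2) and t = less.prems(3) and asc = less.prems(4)
  have word_cong: "root1_coeff t u s = root1_coeff t w s \<and> root2_coeff t u s = root2_coeff t w s
      \<and> rootE_coeff t u s = rootE_coeff t w s"
    if "(u, w) \<in> coxeter_cong (index D) (param D)" for w
    using D.foldr_refl_cong[OF that] E.foldr_refl_cong[of u w] that index_eq param_eq by simp
  obtain u' where u': "(u, u') \<in> coxeter_cong (index D) (param D)" "length u' = ?l u"
    using reduced_word_exists[OF u] .
  show ?case
  proof (cases u' rule: rev_cases)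
    case Nil
    have "admissible (index D) (param D) 1 1 1"
      using admissible_scale[of 1] by simp
    then show ?thesis
      using word_cong[OF u'(1)] s t
      by (simp add: Nil basis_coeff_basis[OF basis1] basis_coeff_basis[OF basis2]
          basis_coeff_basis[OF basisE])
  next
    case (snoc z r)
    have zr: "z \<in> lists (index D)" "r \<in> index D"
      using coxeter_cong_in_lists[OF u'(1)] snoc by auto
    have "(u @ [r], z @ [r, r]) \<in> coxeter_cong (index D) (param D)"
      using coxeter_cong_context[OF u'(1), of "[]" "[r]"] zr snoc by simp
    moreover have "(z @ [r, r], z) \<in> coxeter_cong (index D) (param D)"
      using coxeter_cong_cancel(1)[of z "index D" "[r]"] zr by simp
    ultimately have "?l (u @ [r]) \<le> length z"
      by (blast intro: wlen_le coxeter_cong.cong_trans)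
    then have desc: "?l (u @ [r]) < ?l u"
      using u'(2) snoc by simp
    then have rs: "r \<noteq> s"
      using asc by auto
    then have "param D r s \<noteq> 0"
      using D.side1.m_ge2[OF zr(2) s] by auto
    then obtain v k where v: "v \<in> lists (index D)"
      and uv: "(u, v @ alt r s k) \<in> coxeter_cong (index D) (param D)"
      and lv: "?l v < ?l u" "?l v < ?l (v @ [r])" "?l v < ?l (v @ [s])"
      and k: "\<And>n. param D r s = enat n \<Longrightarrow> k < n"
      using dihedral_decomposition[OF u zr(2) s _ desc asc] by metis
    have "admissible (index D) (param D) (root1_coeff t v x) (root2_coeff t v x) (rootE_coeff t v x)"
      if "x \<in> {r, s}" for x
      using less.hyps[OF lv(1) v _ t, of x] lv(2,3) zr(2) s that by auto
    from dihedral_step[OF zr(2) s rs v k this] show ?thesis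
      using word_cong[OF uv] by simp
  qed
qed

text \<open>If \<open>s\<close> shortens \<open>u\<close>, then it lengthens \<open>u @ [s]\<close>, whose root is the negative one.\<close>

lemma admissible_up_to_sign:
  assumes u: "u \<in> lists (index D)" and s: "s \<in> index D"
  shows "(\<forall>t\<in>index D. admissible (index D) (param D)
        (root1_coeff t u s) (root2_coeff t u s) (rootE_coeff t u s))
    \<or> (\<forall>t\<in>index D. admissible (index D) (param D)
        (- root1_coeff t u s) (- root2_coeff t u s) (- rootE_coeff t u s))"
proof (cases "wlen (index D) (param D) u < wlen (index D) (param D) (u @ [s])")
  case True
  then show ?thesis
    using admissible_if_ascent[OF u s] by blast
next
  case False
  let ?u = "u @ [s]"
  have us: "?u \<in> lists (index D)" "u \<in> lists (index E)"
    using u s index_eq by auto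
  have "wlen (index D) (param D) (?u @ [s]) = wlen (index D) (param D) u"
    using wlen_cong[OF coxeter_cong_cancel(1)[OF u, of "[s]"]] s by simp
  then have asc: "wlen (index D) (param D) ?u < wlen (index D) (param D) (?u @ [s])"
    using wlen_snoc[OF u s, of "param D"] False by linarith
  have "root1_coeff t ?u s = - root1_coeff t u s" "root2_coeff t ?u s = - root2_coeff t u s"
    "rootE_coeff t ?u s = - rootE_coeff t u s" for t
    using D.refl_same[OF s] E.refl_same[of s] s index_eq D.linear_foldr_refl[OF u]
      E.linear_foldr_refl[OF us(2)]
    by (simp_all add: linear_neg basis_coeff_linear[OF basis1] basis_coeff_linear[OF basis2]
        basis_coeff_linear[OF basisE])
  then show ?thesis
    using admissible_if_ascent[OF us(1) s _ asc] by simp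
qed

lemma admissible_with_sign:
  assumes u: "u \<in> lists (index D)" and s: "s \<in> index D"
  obtains e :: real where "e = 1 \<or> e = - 1"
    "\<And>t. t \<in> index D \<Longrightarrow> admissible (index D) (param D)
      (e * root1_coeff t u s) (e * root2_coeff t u s) (e * rootE_coeff t u s)"
proof -
  consider "\<forall>t\<in>index D. admissible (index D) (param D)
        (1 * root1_coeff t u s) (1 * root2_coeff t u s) (1 * rootE_coeff t u s)"
    | "\<forall>t\<in>index D. admissible (index D) (param D)
        (- 1 * root1_coeff t u s) (- 1 * root2_coeff t u s) (- 1 * rootE_coeff t u s)"
    using admissible_up_to_sign[OF u s] by auto
  then show thesis
    using that by cases blast+
qed

lemma coeff_signs:
  assumes u: "u \<in> lists (index D)" and s: "s \<in> index D"
  shows "(\<forall>t\<in>index D. 0 \<le> root1_coeff t u s) \<or> (\<forall>t\<in>index D. root1_coeff t u s \<le> 0)"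
    "(\<forall>t\<in>index D. 0 \<le> root2_coeff t u s) \<or> (\<forall>t\<in>index D. root2_coeff t u s \<le> 0)"
proof -
  obtain e where e: "e = 1 \<or> e = - 1" "\<And>t. t \<in> index D \<Longrightarrow> admissible (index D) (param D)
      (e * root1_coeff t u s) (e * root2_coeff t u s) (e * rootE_coeff t u s)"
    using admissible_with_sign[OF u s] by blast
  have "0 \<le> e * root1_coeff t u s" "0 \<le> e * root2_coeff t u s" if "t \<in> index D" for t
    using e(2)[OF that] by (auto simp: admissible_def)
  then show "(\<forall>t\<in>index D. 0 \<le> root1_coeff t u s) \<or> (\<forall>t\<in>index D. root1_coeff t u s \<le> 0)"
    "(\<forall>t\<in>index D. 0 \<le> root2_coeff t u s) \<or> (\<forall>t\<in>index D. root2_coeff t u s \<le> 0)"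
    using e(1) by auto
qed

text \<open>Since the entries of an admissible triple vanish together, all three roots are multiples of the
simple root at \<open>t\<close>. The factors satisfy $ab = 1$ and $g^2 = 1$ by invariance of the pairings, one of
$a$ and $b$ is $1$ by hypothesis, and $g$ has the sign of $a$.\<close>

lemma simple_root_simultaneously:
  assumes u: "u \<in> lists (index D)" and s: "s \<in> index D" and t: "t \<in> index D"
    and simple: "foldr (refl1 D) u (root1 D s) = root1 D t \<or> foldr (refl2 D) u (root2 D s) = root2 D t"
  shows "foldr (refl1 D) u (root1 D s) = root1 D t \<and> foldr (refl2 D) u (root2 D s) = root2 D t
    \<and> foldr (refl1 E) u (root1 E s) = root1 E t"
proof -
  obtain e where e: "e = 1 \<or> e = - 1" and adm: "\<And>j. j \<in> index D \<Longrightarrow> admissible (index D) (param D)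
      (e * root1_coeff j u s) (e * root2_coeff j u s) (e * rootE_coeff j u s)"
    using admissible_with_sign[OF u s] by blast
  have unit: "(\<forall>j\<in>index D. root1_coeff j u s = of_bool (t = j))
      \<or> (\<forall>j\<in>index D. root2_coeff j u s = of_bool (t = j))"
    using simple basis_coeff_basis[OF basis1 t] basis_coeff_basis[OF basis2 t] by auto
  have off: "root1_coeff j u s = 0 \<and> root2_coeff j u s = 0 \<and> rootE_coeff j u s = 0"
    if j: "j \<in> index D" "j \<noteq> t" for j
  proof -
    have "root1_coeff j u s = 0 \<or> root2_coeff j u s = 0"
      using unit j by auto
    then show ?thesis
      using adm[OF j(1)] e by (auto simp: admissible_def)
  qed
  define a b g where "a = root1_coeff t u s" and "b = root2_coeff t u s" and "g = rootE_coeff t u s"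
  have ab: "a = 1 \<or> b = 1"
    using unit t by (auto simp: a_def b_def)
  have "0 < e * a" "0 < e * b" "1 \<le> e * g"
    using admissible_nonzero[OF adm[OF t]] ab e by (auto simp: a_def b_def g_def)
  then have pos: "0 < g"
    using ab e by auto
  have x1: "foldr (refl1 D) u (root1 D s) = a *\<^sub>R root1 D t"
    by (rule basis_coeff_eqI[OF basis1])
      (use off in \<open>auto simp: a_def basis_coeff_linear[OF basis1] basis_coeff_basis[OF basis1 t]\<close>)
  have x2: "foldr (refl2 D) u (root2 D s) = b *\<^sub>R root2 D t"
    by (rule basis_coeff_eqI[OF basis2])
      (use off in \<open>auto simp: b_def basis_coeff_linear[OF basis2] basis_coeff_basis[OF basis2 t]\<close>)
  have xE: "foldr (refl1 E) u (root1 E s) = g *\<^sub>R root1 E t"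
    by (rule basis_coeff_eqI[OF basisE])
      (use off in \<open>auto simp: g_def basis_coeff_linear[OF basisE] basis_coeff_basis[OF basisE t]\<close>)
  have "a * b = 1"
    using D.pairing_invariant[OF u, of "root1 D s" "root2 D s"] D.side1.K_diag[OF s]
      D.side1.K_diag[OF t] D.bilinear_pairing
    unfolding x1 x2 by (simp add: bilinear_lmul bilinear_rmul)
  then have "a = 1" "b = 1"
    using ab by auto
  have "refl2 E = refl1 E"
    by (simp add: fun_eq_iff refl1_def refl2_def root2_E pairing_E_sym[of "root1 E _"])
  then have "g * g = 1"
    using E.pairing_invariant[of u "root1 E s" "root2 E s"] E.side1.K_diag[of s]
      E.side1.K_diag[of t] E.bilinear_pairing s t u index_eq
    by (simp add: root2_E xE bilinear_lmul bilinear_rmul)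
  then have "g = 1"
    using pos by (simp add: square_eq_1_iff)
  with \<open>a = 1\<close> \<open>b = 1\<close> show ?thesis
    using x1 x2 xE by simp
qed

lemma roots_equal_simultaneously:
  assumes u: "u \<in> lists (index D)" "s \<in> index D" and w: "w \<in> lists (index D)" "t \<in> index D"
    and eq: "foldr (refl1 D) u (root1 D s) = foldr (refl1 D) w (root1 D t)
      \<or> foldr (refl2 D) u (root2 D s) = foldr (refl2 D) w (root2 D t)"
  shows "foldr (refl1 D) u (root1 D s) = foldr (refl1 D) w (root1 D t)"
    "foldr (refl2 D) u (root2 D s) = foldr (refl2 D) w (root2 D t)"
    "foldr (refl1 E) u (root1 E s) = foldr (refl1 E) w (root1 E t)"
proof -
  have rw: "rev w \<in> lists (index D)" "rev w \<in> lists (index E)"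
    using rev_in_lists[OF w(1)] index_eq by simp_all
  have ru: "rev w @ u \<in> lists (index D)"
    using rw(1) u(1) by simp
  have "foldr (refl1 D) (rev w @ u) (root1 D s) = root1 D t
      \<or> foldr (refl2 D) (rev w @ u) (root2 D s) = root2 D t"
    using eq D.foldr_refl_rev[OF w(1)] by auto
  from simple_root_simultaneously[OF ru u(2) w(2) this]
  have *: "foldr (refl1 D) (rev w) (foldr (refl1 D) u (root1 D s)) = root1 D t"
    "foldr (refl2 D) (rev w) (foldr (refl2 D) u (root2 D s)) = root2 D t"
    "foldr (refl1 E) (rev w) (foldr (refl1 E) u (root1 E s)) = root1 E t"
    by auto
  show "foldr (refl1 D) u (root1 D s) = foldr (refl1 D) w (root1 D t)"
    using arg_cong[OF *(1), of "foldr (refl1 D) w"] D.foldr_refl_rev(1)[OF rw(1)] by simp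
  show "foldr (refl2 D) u (root2 D s) = foldr (refl2 D) w (root2 D t)"
    using arg_cong[OF *(2), of "foldr (refl2 D) w"] D.foldr_refl_rev(2)[OF rw(1)] by simp
  show "foldr (refl1 E) u (root1 E s) = foldr (refl1 E) w (root1 E t)"
    using arg_cong[OF *(3), of "foldr (refl1 E) w"] E.foldr_refl_rev(1)[OF rw(2)] by simp
qed

end

section \<open>The maps between root systems\<close>

text \<open>Roots are parametrized by words and simple roots, in many ways; \<open>X\<close> and \<open>Y\<close> will be such
parametrizations of two root systems.\<close>

lemma map_between_families:
  assumes "\<And>i j. i \<in> I \<Longrightarrow> j \<in> I \<Longrightarrow> X i = X j \<Longrightarrow> Y i = Y j"
  obtains h where "h \<in> extensional (X ` I)" "\<And>i. i \<in> I \<Longrightarrow> h (X i) = Y i"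
proof
  let ?h = "restrict (\<lambda>x. Y (inv_into I X x)) (X ` I)"
  show "?h \<in> extensional (X ` I)" by simp
  show "?h (X i) = Y i" if "i \<in> I" for i
    using that assms[of "inv_into I X (X i)" i] by (simp add: inv_into_into f_inv_into_f)
qed

locale realized_datum =
  fixes C :: "('s, 'v1::real_vector, 'v2::real_vector) coxeter_tuple"
    and C' :: "('s, 'w1::real_vector, 'w2::real_vector) coxeter_tuple"
    and G :: "('s, 'v::real_vector, 'v) coxeter_tuple"
  assumes datum: "coxeter_datum C"
    and free: "free_datum C C'"
    and std: "standard_realization C G"
begin

abbreviation "S \<equiv> index C"

lemma same_index: "index C' = S" "index G = S" "param C' = param C" "param G = param C"
  using free std by (simp_all add: free_datum_def standard_realization_def)

sublocale C: root_datum C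
  using root_datum_if_coxeter_datum[OF datum] .

sublocale pair: symmetrized_pair C' G
proof (intro symmetrized_pair.intro symmetrized_pair_axioms.intro root_datum.intro)
  have matrix: "pairing_matrix C' s t = pairing_matrix C s t" if "s \<in> S" "t \<in> S" for s t
    using free that by (simp add: free_datum_def)
  have sq: "(pairing_matrix G s t)\<^sup>2 = pairing_matrix C s t * pairing_matrix C t s"
    if "s \<in> S" "t \<in> S" for s t
    using std that by (simp add: standard_realization_def)
  show sym: "pairing G x y = pairing G y x" for x y
    using std by (simp add: standard_realization_def)
  show r2: "root2 G = root1 G"
    using std by (simp add: standard_realization_def)
  show "index G = index C'" "param G = param C'"
    by (simp_all add: same_index)
  show "bilinear (pairing C')" "bilinear (pairing G)"
    using free std by (simp_all add: free_datum_def standard_realization_def)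
  show "basis_family (index C') (root1 C')" "basis_family (index C') (root2 C')"
    "basis_family (index C') (root1 G)"
    using free std by (simp_all add: free_datum_def standard_realization_def)
  show "param C' s t = param C' t s" if "s \<in> index C'" "t \<in> index C'" for s t
    using C.param_sym that by (simp add: same_index)
  show "param G s t = param G t s" if "s \<in> index G" "t \<in> index G" for s t
    using C.param_sym that by (simp add: same_index)
  show "(pairing_matrix G s t)\<^sup>2 = pairing_matrix C' s t * pairing_matrix C' t s"
    if "s \<in> index C'" "t \<in> index C'" for s t
    using sq[of s t] matrix that by (simp add: same_index)
  show "coxeter_gram (index C') (param C') (pairing_matrix C')"
    unfolding same_index
  proof (rule C.side1.same_products)
    fix s t assume "s \<in> S" "t \<in> S"
    then show "pairing_matrix C' s t = 0 \<longleftrightarrow> pairing_matrix C' t s = 0"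
      using C.side1.K_zero by (simp add: matrix)
  qed (use matrix C.side1.K_diag C.side1.K_nonpos in auto)
  show "coxeter_gram (index G) (param G) (pairing_matrix G)"
    unfolding same_index
  proof (rule C.side1.same_products)
    fix s t assume st: "s \<in> S" "t \<in> S"
    show "pairing_matrix G s t = 0 \<longleftrightarrow> pairing_matrix G t s = 0"
      by (simp add: r2 sym[of "root1 G s"])
    show "pairing_matrix G s t * pairing_matrix G t s = pairing_matrix C s t * pairing_matrix C t s"
      using sq[OF st] by (simp add: r2 sym[of "root1 G t"] power2_eq_square)
  qed (use std in \<open>simp_all add: standard_realization_def\<close>)
qed

text \<open>The root of a word in each of the five realizations: the two halves of the given datum, the two
halves of the free datum, and the standard realization.\<close>

abbreviation "rt1 u s \<equiv> foldr (refl1 C) u (root1 C s)"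
abbreviation "rt2 u s \<equiv> foldr (refl2 C) u (root2 C s)"
abbreviation "rt1' u s \<equiv> foldr (refl1 C') u (root1 C' s)"
abbreviation "rt2' u s \<equiv> foldr (refl2 C') u (root2 C' s)"
abbreviation "rtG u s \<equiv> foldr (refl1 G) u (root1 G s)"

lemma free_rep1:
  "reflection_rep S (param C) (pairing_matrix C) (root1 C') (\<lambda>s x. pairing C' x (root2 C' s))"
  using pair.D.side1.linear_f C.gram free
  by (auto simp: reflection_rep_def reflection_rep_axioms_def same_index free_datum_def)

lemma free_rep2:
  "reflection_rep S (param C) (\<lambda>s t. pairing_matrix C t s) (root2 C') (\<lambda>s y. pairing C' (root1 C' s) y)"
  using pair.D.side2.linear_f C.side2.coxeter_gram_axioms free
  by (auto simp: reflection_rep_def reflection_rep_axioms_def same_index free_datum_def)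

lemma proj1_props: "linear (proj1 C C')" "s \<in> S \<Longrightarrow> proj1 C C' (root1 C' s) = root1 C s"
  using theI'[OF basis_linear_extension[OF pair.basis1, of "root1 C"]]
  unfolding proj1_def same_index by auto

lemma proj2_props: "linear (proj2 C C')" "s \<in> S \<Longrightarrow> proj2 C C' (root2 C' s) = root2 C s"
  using theI'[OF basis_linear_extension[OF pair.basis2, of "root2 C"]]
  unfolding proj2_def same_index by auto

lemma proj1_root:
  assumes "u \<in> lists S" "s \<in> S"
  shows "proj1 C C' (rt1' u s) = rt1 u s"
  using projection_equivariant[OF free_rep1 C.side1.reflection_rep_axioms
      pair.basis1[unfolded same_index] proj1_props(1) _ assms(1)] proj1_props(2) assms(2)
  by (simp add: refl1_eq_reflection)

lemma proj2_root:
  assumes "u \<in> lists S" "s \<in> S"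
  shows "proj2 C C' (rt2' u s) = rt2 u s"
  using projection_equivariant[OF free_rep2 C.side2.reflection_rep_axioms
      pair.basis2[unfolded same_index] proj2_props(1) _ assms(1)] proj2_props(2) assms(2)
  by (simp add: refl2_eq_reflection)

lemma plc: "0 \<notin> PLC (root1 C ` S)" "0 \<notin> PLC (root2 C ` S)"
  using datum unfolding coxeter_datum_def by - (elim conjE, assumption)+

text \<open>This makes the root in the free datum that lies over a given root unique, and hence the canonical
coefficients well defined.\<close>

lemma rt1_eq_iff:
  assumes "u \<in> lists S" "s \<in> S" "w \<in> lists S" "t \<in> S"
  shows "rt1 u s = rt1 w t \<longleftrightarrow> rt1' u s = rt1' w t"
proof
  assume "rt1 u s = rt1 w t"
  then have eq: "proj1 C C' (rt1' u s) = proj1 C C' (rt1' w t)"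
    using assms by (simp add: proj1_root del: in_lists_conv_set)
  show "rt1' u s = rt1' w t"
    unfolding refl1_eq_reflection
    by (rule projection_inj_on_roots[OF free_rep1 C.side1.reflection_rep_axioms
          pair.basis1[unfolded same_index] plc(1) proj1_props(1) _ _ assms
          eq[unfolded refl1_eq_reflection]])
      (use proj1_props(2) pair.coeff_signs(1)[unfolded same_index refl1_eq_reflection] in auto)
next
  assume "rt1' u s = rt1' w t"
  then show "rt1 u s = rt1 w t"
    using proj1_root[OF assms(1,2)] proj1_root[OF assms(3,4)] by metis
qed

lemma rt2_eq_iff:
  assumes "u \<in> lists S" "s \<in> S" "w \<in> lists S" "t \<in> S"
  shows "rt2 u s = rt2 w t \<longleftrightarrow> rt2' u s = rt2' w t"
proof
  assume "rt2 u s = rt2 w t"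
  then have eq: "proj2 C C' (rt2' u s) = proj2 C C' (rt2' w t)"
    using assms by (simp add: proj2_root del: in_lists_conv_set)
  show "rt2' u s = rt2' w t"
    unfolding refl2_eq_reflection
    by (rule projection_inj_on_roots[OF free_rep2 C.side2.reflection_rep_axioms
          pair.basis2[unfolded same_index] plc(2) proj2_props(1) _ _ assms
          eq[unfolded refl2_eq_reflection]])
      (use proj2_props(2) pair.coeff_signs(2)[unfolded same_index refl2_eq_reflection] in auto)
next
  assume "rt2' u s = rt2' w t"
  then show "rt2 u s = rt2 w t"
    using proj2_root[OF assms(1,2)] proj2_root[OF assms(3,4)] by metis
qed

lemma coeff1_root:
  assumes u: "u \<in> lists S" "s \<in> S"
  shows "coeff1 C C' t (rt1 u s) = pair.root1_coeff t u s"
proof -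
  have "(THE z'. z' \<in> Phi1 C' \<and> proj1 C C' z' = rt1 u s) = rt1' u s"
  proof (rule the_equality)
    show "rt1' u s \<in> Phi1 C' \<and> proj1 C C' (rt1' u s) = rt1 u s"
      using proj1_root[OF u] u unfolding pair.D.Phi1_eq same_index by blast
  next
    fix z' assume z': "z' \<in> Phi1 C' \<and> proj1 C C' z' = rt1 u s"
    then obtain w r where "w \<in> lists S" "r \<in> S" "z' = rt1' w r"
      unfolding pair.D.Phi1_eq same_index by blast
    then show "z' = rt1' u s"
      using z' proj1_root rt1_eq_iff u by metis
  qed
  then show ?thesis
    by (simp add: coeff1_def same_index)
qed

lemma coeff2_root:
  assumes u: "u \<in> lists S" "s \<in> S"
  shows "coeff2 C C' t (rt2 u s) = pair.root2_coeff t u s"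
proof -
  have "(THE z'. z' \<in> Phi2 C' \<and> proj2 C C' z' = rt2 u s) = rt2' u s"
  proof (rule the_equality)
    show "rt2' u s \<in> Phi2 C' \<and> proj2 C C' (rt2' u s) = rt2 u s"
      using proj2_root[OF u] u unfolding pair.D.Phi2_eq same_index by blast
  next
    fix z' assume z': "z' \<in> Phi2 C' \<and> proj2 C C' z' = rt2 u s"
    then obtain w r where "w \<in> lists S" "r \<in> S" "z' = rt2' w r"
      unfolding pair.D.Phi2_eq same_index by blast
    then show "z' = rt2' u s"
      using z' proj2_root rt2_eq_iff u by metis
  qed
  then show ?thesis
    by (simp add: coeff2_def same_index)
qed

text \<open>The two implications say that $\phi$ and $\phi_1$ are well defined, and the converse in the first one
that $\phi$ is injective. The map $\phi_1$ need not be injective: a positive multiple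
$\lambda\alpha_s$ of a simple root may be a root as well and is mapped to $\gamma_s$.\<close>

lemma rt1_determines:
  assumes "u \<in> lists S" "s \<in> S" "w \<in> lists S" "t \<in> S"
  shows "rt1 u s = rt1 w t \<longleftrightarrow> rt2 u s = rt2 w t" "rt1 u s = rt1 w t \<Longrightarrow> rtG u s = rtG w t"
  using pair.roots_equal_simultaneously[of u s w t, unfolded same_index, OF assms]
    rt1_eq_iff[OF assms] rt2_eq_iff[OF assms] by blast+

lemma act_on_Phi1:
  assumes "u \<in> lists S" "w \<in> lists S" "s \<in> S"
  shows "act1 C (coxeter_cong S (param C) `` {u}) (rt1 w s) = rt1 (u @ w) s"
    "act2 C (coxeter_cong S (param C) `` {u}) (rt2 w s) = rt2 (u @ w) s"
    "act1 G (coxeter_cong S (param C) `` {u}) (rtG w s) = rtG (u @ w) s"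
  using C.act_class[OF assms(1)] pair.E.act_class(1)[of u] assms by (simp_all add: same_index)

lemma Phi1_elim:
  assumes "x \<in> Phi1 C"
  obtains u s where "u \<in> lists S" "s \<in> S" "x = rt1 u s"
  using assms unfolding C.Phi1_eq by blast

lemma Phi1_intro: "u \<in> lists S \<Longrightarrow> s \<in> S \<Longrightarrow> rt1 u s \<in> Phi1 C"
  unfolding C.Phi1_eq by blast

lemma simple_in_Phi1: "s \<in> S \<Longrightarrow> root1 C s \<in> Phi1 C"
  using Phi1_intro[of "[]" s] by simp

lemma carrier_elim:
  assumes "w \<in> carrier (W C)"
  obtains u where "u \<in> lists S" "w = coxeter_cong S (param C) `` {u}"
  using assms unfolding carrier_coxeter_group by blast

lemma carrier_intro: "u \<in> lists S \<Longrightarrow> coxeter_cong S (param C) `` {u} \<in> carrier (W C)"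
  unfolding carrier_coxeter_group by blast

text \<open>Every root is obtained from a simple root by the action, so an equivariant map is determined by its
values on simple roots; being extensional fixes it elsewhere.\<close>

lemma equivariant_unique:
  assumes "h \<in> extensional (Phi1 C)" "h' \<in> extensional (Phi1 C)"
    and "\<forall>w\<in>carrier (W C). \<forall>x\<in>Phi1 C. h (act1 C w x) = a w (h x)"
    and "\<forall>w\<in>carrier (W C). \<forall>x\<in>Phi1 C. h' (act1 C w x) = a w (h' x)"
    and "\<forall>s\<in>S. h (root1 C s) = h' (root1 C s)"
  shows "h = h'"
proof (rule extensionalityI[OF assms(1,2)])
  fix x assume "x \<in> Phi1 C"
  then obtain u s where x: "u \<in> lists S" "s \<in> S" "x = rt1 u s"
    by (rule Phi1_elim)
  then have "x = act1 C (coxeter_cong S (param C) `` {u}) (root1 C s)"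
    using C.act_class(1) by simp
  then show "h x = h' x"
    using assms(3-5) carrier_intro[OF x(1)] simple_in_Phi1[OF x(2)] x(2) by simp
qed

lemma phi_root:
  assumes "u \<in> lists S" "s \<in> S"
  shows "phi C (rt1 u s) = rt2 u s"
proof -
  let ?I = "lists S \<times> S"
  let ?P = "\<lambda>f. f \<in> extensional (Phi1 C) \<and> bij_betw f (Phi1 C) (Phi2 C) \<and>
     (\<forall>w\<in>carrier (W C). \<forall>x\<in>Phi1 C. f (act1 C w x) = act2 C w (f x)) \<and>
     (\<forall>s\<in>S. f (root1 C s) = root2 C s)"
  have Phi: "Phi1 C = (\<lambda>(u, s). rt1 u s) ` ?I" "Phi2 C = (\<lambda>(u, s). rt2 u s) ` ?I"
    unfolding C.Phi1_eq C.Phi2_eq by force+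
  obtain h where h: "h \<in> extensional (Phi1 C)"
    and hr: "\<And>u s. u \<in> lists S \<Longrightarrow> s \<in> S \<Longrightarrow> h (rt1 u s) = rt2 u s"
  proof (rule map_between_families[of ?I "\<lambda>(u, s). rt1 u s" "\<lambda>(u, s). rt2 u s"])
    show "(\<lambda>(u, s). rt2 u s) i = (\<lambda>(u, s). rt2 u s) j"
      if "i \<in> ?I" "j \<in> ?I" "(\<lambda>(u, s). rt1 u s) i = (\<lambda>(u, s). rt1 u s) j" for i j
      using that rt1_determines(1) by (auto simp del: in_lists_conv_set)
  qed (use that Phi in fastforce)
  have "bij_betw h (Phi1 C) (Phi2 C)"
  proof (rule bij_betw_imageI)
    show "inj_on h (Phi1 C)"
    proof (rule inj_onI)
      fix x y assume xy: "x \<in> Phi1 C" "y \<in> Phi1 C" "h x = h y"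
      then obtain u s w t where "u \<in> lists S" "s \<in> S" "x = rt1 u s" "w \<in> lists S" "t \<in> S" "y = rt1 w t"
        by (metis Phi1_elim)
      then show "x = y"
        using xy(3) hr rt1_determines(1) by simp
    qed
    show "h ` Phi1 C = Phi2 C"
      unfolding Phi image_image by (rule image_cong) (use hr in auto)
  qed
  moreover have "h (act1 C w x) = act2 C w (h x)" if w: "w \<in> carrier (W C)" and x: "x \<in> Phi1 C" for w x
  proof -
    obtain v where "v \<in> lists S" "w = coxeter_cong S (param C) `` {v}"
      using w by (rule carrier_elim)
    moreover obtain u s where "u \<in> lists S" "s \<in> S" "x = rt1 u s"
      using x by (rule Phi1_elim)
    ultimately show ?thesis
      using hr[of "v @ u" s] hr[of u s] act_on_Phi1[of v u s] by simp
  qed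
  moreover have "h (root1 C s) = root2 C s" if "s \<in> S" for s
    using hr[of "[]" s] that by simp
  ultimately have Ph: "?P h"
    using h by blast
  have "phi C = h"
    unfolding phi_def
  proof (rule the_equality)
    show "?P h" by (rule Ph)
    show "f = h" if "?P f" for f
      using that Ph by (intro equivariant_unique[of f h "act2 C"]) auto
  qed
  then show ?thesis
    using hr assms by simp
qed

lemma phi_std_root:
  assumes "u \<in> lists S" "s \<in> S"
  shows "phi_std C G (rt1 u s) = rtG u s"
proof -
  let ?I = "lists S \<times> S"
  let ?P = "\<lambda>f. f \<in> Phi1 C \<rightarrow>\<^sub>E Phi1 G \<and>
     (\<forall>w\<in>carrier (W C). \<forall>x\<in>Phi1 C. f (act1 C w x) = act1 G w (f x)) \<and>
     (\<forall>s\<in>S. f (root1 C s) = root1 G s)"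
  have Phi: "Phi1 C = (\<lambda>(u, s). rt1 u s) ` ?I"
    unfolding C.Phi1_eq by force
  obtain h where h: "h \<in> extensional (Phi1 C)"
    and hr: "\<And>u s. u \<in> lists S \<Longrightarrow> s \<in> S \<Longrightarrow> h (rt1 u s) = rtG u s"
  proof (rule map_between_families[of ?I "\<lambda>(u, s). rt1 u s" "\<lambda>(u, s). rtG u s"])
    show "(\<lambda>(u, s). rtG u s) i = (\<lambda>(u, s). rtG u s) j"
      if "i \<in> ?I" "j \<in> ?I" "(\<lambda>(u, s). rt1 u s) i = (\<lambda>(u, s). rt1 u s) j" for i j
      using that rt1_determines(2) by (auto simp del: in_lists_conv_set)
  qed (use that Phi in fastforce)
  have "h x \<in> Phi1 G" if x: "x \<in> Phi1 C" for x
  proof -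
    obtain u s where "u \<in> lists S" "s \<in> S" "x = rt1 u s"
      using x by (rule Phi1_elim)
    then show ?thesis
      using hr unfolding pair.E.Phi1_eq same_index by blast
  qed
  moreover have "h (act1 C w x) = act1 G w (h x)" if w: "w \<in> carrier (W C)" and x: "x \<in> Phi1 C" for w x
  proof -
    obtain v where "v \<in> lists S" "w = coxeter_cong S (param C) `` {v}"
      using w by (rule carrier_elim)
    moreover obtain u s where "u \<in> lists S" "s \<in> S" "x = rt1 u s"
      using x by (rule Phi1_elim)
    ultimately show ?thesis
      using hr[of "v @ u" s] hr[of u s] act_on_Phi1[of v u s] by simp
  qed
  moreover have "h (root1 C s) = root1 G s" if "s \<in> S" for s
    using hr[of "[]" s] that by simp
  ultimately have Ph: "?P h"
    using h by (auto simp: PiE_def)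
  have "phi_std C G = h"
    unfolding phi_std_def
  proof (rule the_equality)
    show "?P h" by (rule Ph)
    show "f = h" if "?P f" for f
      using that Ph by (intro equivariant_unique[of f h "act1 G"]) (auto simp: PiE_def)
  qed
  then show ?thesis
    using hr assms by simp
qed

text \<open>A vector that is both a positive and a nonpositive combination of the simple roots would give zero
as a positive combination.\<close>

lemma positive_root_not_nonpos:
  assumes u: "u \<in> lists S" "s \<in> S" and pos: "rt1 u s \<in> PLC (root1 C ` S)"
    and neg: "\<And>j. j \<in> S \<Longrightarrow> pair.root1_coeff j u s \<le> 0"
  shows False
proof -
  obtain F where F: "finite F" "F \<subseteq> S"
    "rt1' u s = (\<Sum>j\<in>F. basis_coeff S (root1 C') (rt1' u s) j *\<^sub>R root1 C' j)"
    by (rule basis_expansion[OF pair.basis1[unfolded same_index], of "rt1' u s"])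
  have "proj1 C C' (\<Sum>j\<in>F. c j *\<^sub>R root1 C' j) = (\<Sum>j\<in>F. c j *\<^sub>R root1 C j)" for c
    using F(2) proj1_props by (auto simp: linear_sum linear_scale intro!: sum.cong)
  then have "rt1 u s = (\<Sum>j\<in>F. basis_coeff S (root1 C') (rt1' u s) j *\<^sub>R root1 C j)"
    using F(3) proj1_root[OF u] by metis
  from C.side1.PLC_not_nonpos_combination[OF plc(1) pos F(1,2) this] show False
    using neg F(2) by (auto simp: same_index)
qed

end

section \<open>Coefficients of corresponding roots\<close>

text \<open>The sign \<open>e\<close> is $1$ for positive and $-1$ for negative roots. It cancels in products of two
coefficients, which is why only the last assertion needs the root to be positive.\<close>

theorem proposition4p11:
  fixes C :: "('s, 'v1::real_vector, 'v2::real_vector) coxeter_tuple"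
    and C' :: "('s, 'w1::real_vector, 'w2::real_vector) coxeter_tuple"
    and G :: "('s, 'v::real_vector, 'v) coxeter_tuple"
    and \<alpha> :: 'v1 and t :: 's
  assumes "coxeter_datum C"
    and "free_datum C C'"
    and "standard_realization C G"
    and "\<alpha> \<in> Phi1 C"
    and "t \<in> index C"
  shows "(0 < coeff1 C C' t \<alpha> \<longleftrightarrow> 0 < coeff2 C C' t (phi C \<alpha>))
    \<and> (0 < coeff1 C C' t \<alpha> \<longrightarrow> 1 \<le> coeff1 C C' t \<alpha> * coeff2 C C' t (phi C \<alpha>))
    \<and> phi C ` supp1 C C' \<alpha> = supp2 C C' (phi C \<alpha>)
    \<and> (1 \<le> coeff1 C C' t \<alpha> * coeff2 C C' t (phi C \<alpha>)
        \<and> coeff1 C C' t \<alpha> * coeff2 C C' t (phi C \<alpha>) < 4 \<longrightarrow>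
          coeff1 C C' t \<alpha> * coeff2 C C' t (phi C \<alpha>) = 1
          \<or> (\<exists>r1\<in>index C. \<exists>r2\<in>index C. \<exists>m::nat. param C r1 r2 = enat m \<and> 4 \<le> m
                \<and> coeff1 C C' t \<alpha> * coeff2 C C' t (phi C \<alpha>) = 4 * (cos (pi / real m))\<^sup>2))
    \<and> (\<alpha> \<in> Phi1_pos C \<longrightarrow>
          (coeff1 C C' t \<alpha> * coeff2 C C' t (phi C \<alpha>) = 1
            \<longleftrightarrow> coeff_std G t (phi_std C G \<alpha>) = 1))"
proof -
  interpret realized_datum C C' G
    by unfold_locales fact+
  obtain u s where u: "u \<in> lists S" "s \<in> S" and \<alpha>: "\<alpha> = rt1 u s"
    using Phi1_elim[OF assms(4)] .
  define a b g where "a = (\<lambda>j. pair.root1_coeff j u s)" and "b = (\<lambda>j. pair.root2_coeff j u s)"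
    and "g = (\<lambda>j. pair.rootE_coeff j u s)"
  have coeffs: "coeff1 C C' j \<alpha> = a j" "coeff2 C C' j (phi C \<alpha>) = b j"
    "coeff_std G j (phi_std C G \<alpha>) = g j" for j
    by (simp_all add: \<alpha> phi_root[OF u] phi_std_root[OF u] coeff1_root[OF u] coeff2_root[OF u]
        coeff_std_def a_def b_def g_def same_index)
  obtain e :: real where e: "e = 1 \<or> e = - 1"
    and adm: "\<And>j. j \<in> S \<Longrightarrow> admissible S (param C) (e * a j) (e * b j) (e * g j)"
    using pair.admissible_with_sign[of u s] u unfolding a_def b_def g_def same_index by blast
  have ee: "(e * x) * (e * y) = x * y" for x y
    using e by auto
  have supp: "a j \<noteq> 0 \<longleftrightarrow> b j \<noteq> 0" if "j \<in> S" for j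
    using adm[OF that] e by (auto simp: admissible_def)
  have phi_simple: "phi C (root1 C j) = root2 C j" if "j \<in> S" for j
    using phi_root[of "[]" j] that by simp
  have 1: "0 < a t \<longleftrightarrow> 0 < b t"
    using adm[OF assms(5)] e by (auto simp: admissible_def)
  have 2: "1 \<le> a t * b t" if "0 < a t"
    using admissible_nonzero(4)[OF adm[OF assms(5)]] that e unfolding ee by auto
  have 3: "phi C ` supp1 C C' \<alpha> = supp2 C C' (phi C \<alpha>)"
  proof -
    have "supp1 C C' \<alpha> = root1 C ` {j \<in> S. a j \<noteq> 0}"
      by (auto simp: supp1_def coeffs)
    moreover have "supp2 C C' (phi C \<alpha>) = root2 C ` {j \<in> S. a j \<noteq> 0}"
      using supp by (auto simp: supp2_def coeffs)
    ultimately show ?thesis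
      by (auto simp: image_image phi_simple intro!: image_cong)
  qed
  have 4: "a t * b t = 1 \<or> (\<exists>r1\<in>S. \<exists>r2\<in>S. \<exists>m. param C r1 r2 = enat m \<and> 4 \<le> m
      \<and> a t * b t = 4 * (cos (pi / real m))\<^sup>2)" if bounds: "1 \<le> a t * b t" "a t * b t < 4"
  proof -
    obtain x where x: "a t * b t = x\<^sup>2" "dihedral_value S (param C) x"
      using adm[OF assms(5)] bounds e unfolding admissible_def ee by auto
    have square: "(2 * cos y)\<^sup>2 = 4 * (cos y)\<^sup>2" for y :: real
      by (simp add: power_mult_distrib)
    from x(2)[unfolded dihedral_value_def] show ?thesis
    proof
      assume "x = 1"
      then show ?thesis using x(1) by simp
    next
      assume "\<exists>r\<in>S. \<exists>s\<in>S. \<exists>k. param C r s = enat k \<and> 4 \<le> k \<and> x = 2 * cos (pi / real k)"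
      then show ?thesis using x(1) square by metis
    qed
  qed
  have 5: "a t * b t = 1 \<longleftrightarrow> g t = 1" if "\<alpha> \<in> Phi1_pos C"
  proof -
    have "e = 1"
    proof (rule ccontr)
      assume "e \<noteq> 1"
      then have "a j \<le> 0" if "j \<in> S" for j
        using adm[OF that] e by (auto simp: admissible_def)
      then show False
        using positive_root_not_nonpos[OF u] that unfolding Phi1_pos_def \<alpha> a_def by blast
    qed
    then have adm1: "admissible S (param C) (a t) (b t) (g t)"
      using adm[OF assms(5)] by simp
    then show ?thesis
      using admissible_nonzero(3)[OF adm1] by (auto simp: admissible_def power2_eq_1_iff)
  qed
  show ?thesis
    unfolding coeffs using 1 2 3 4 5 by blast
qed

end
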